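(* Let $(\mathbb{C},p)$ be a natural model and let $(\mathbb{D},q:\dot{\mathcal{V}}\to\mathcal{V})$ be a natural model with a distinguished basic type $O\in\mathcal{V}(\star)$, where $\star$ is the distinguished terminal object of $\mathbb{D}$. For each morphism of natural models $F:(\mathbb{C},p)\to(\mathbb{D},q)$, there is a unique morphism of natural models $F^\sharp:(\mathbb{C}_X,p_X)\to(\mathbb{D},q)$ such that $F^\sharp\circ I=F$ and $F^\sharp X=O$.
   Context: $\mathsf{y}$ is the Yoneda embedding; elements $x\in P(\Gamma)$ of a presheaf are identified with maps $\mathsf{y}(\Gamma)\to P$, and $x[\sigma]=P(\sigma)(x)$. A natural model $(\mathbb{C},p)$ consists of a small category $\mathbb{C}$ with a distinguished terminal object $\diamond$, presheaves $\mathcal{U},\dot{\mathcal{U}}$ on $\mathbb{C}$, a natural transformation $p:\dot{\mathcal{U}}\to\mathcal{U}$ and, for each object $\Gamma$ and $A\in\mathcal{U}(\Gamma)$, a chosen object $\Gamma\cdot A$, morphism $\mathsf{p}_A:\Gamma\cdot A\to\Gamma$ and element $\mathsf{q}_A\in\dot{\mathcal{U}}(\Gamma\cdot A)$ such that the square with top $\mathsf{q}_A$, right $p$, left $\mathsf{y}(\mathsf{p}_A)$, bottom $A$ is a pullback. A morphism of natural models $F:(\mathbb{C},p)\to(\mathbb{D},q)$ is a functor $F:\mathbb{C}\to\mathbb{D}$ strictly preserving distinguished terminal objects together with functions $A\mapsto FA:\mathcal{U}(\Gamma)\to\mathcal{V}(F\Gamma)$ and $a\mapsto Fa:\dot{\mathcal{U}}(\Gamma)\to\dot{\mathcal{V}}(F\Gamma)$,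 natural in $\Gamma$, with $q(Fa)=F(p(a))$ and strictly preserving the chosen data: $F(\Gamma\cdot A)=F\Gamma\cdot FA$, $F(\mathsf{p}_A)=\mathsf{p}_{FA}$, $F(\mathsf{q}_A)=\mathsf{q}_{FA}$. **The free natural model $(\mathbb{C}_X,p_X)$ on $(\mathbb{C},p)$ extended by a basic type $X$.** Objects of $\mathbb{C}_X$ are lists $(\Gamma,k_0,A_1,k_1,\dots,A_n,k_n)$, $n\ge0$, with $\Gamma\in\mathrm{ob}(\mathbb{C})$, $k_i\in\mathbb{N}$ and $A_i\in\mathcal{U}(\Gamma\cdot A_1\cdots A_{i-1})$, where $(\Gamma,0,A_1,k_1,\dots,A_n,k_n)$ is identified with $(\Gamma\cdot A_1,k_1,\dots,A_n,k_n)$. A morphism $(\Delta,\ell_0,B_1,\dots,B_m,\ell_m)\to(\Gamma,k_0,A_1,\dots,A_n,k_n)$ is a pair $(\sigma,h)$ with $\sigma:\Delta\cdot B_1\cdots B_m\to\Gamma\cdot A_1\cdots A_n$ in $\mathbb{C}$ and $h$ a function from $k_0+\dots+k_n$ to $\ell_0+\dots+\ell_m$ (natural numbers viewed as finite ordinals); composition and identities are as in $\mathbb{C}\times\mathbf{Fin}^{\mathrm{op}}$. The terminal object is $(\diamond,0)$. For $\vec\Gamma=(\Gamma,k_0,A_1,\dots,A_n,k_n)$ and $k=k_0+\dots+k_n$: $\mathcal{U}_X(\vec\Gamma)=\{X\}+\mathcal{U}(\Gamma\cdot A_1\cdots A_n)$ and $\dot{\mathcal{U}}_X(\vec\Gamma)=k+\dot{\mathcal{U}}(\Gamma\cdot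 A_1\cdots A_n)$, a morphism $(\sigma,h)$ acting trivially on $X$, by $h$ on the summand $k$, and by $\sigma$ on the other summands; $p_X$ sends every element of $k$ to $X$ and acts as $p$ on the other summand. Representability data: $\vec\Gamma\cdot X=(\Gamma,k_0,A_1,\dots,A_n,k_n+1)$ with projection $(\mathrm{id},\ k\hookrightarrow k+1)$ and variable the new element $k\in k+1$; for $A\in\mathcal{U}(\Gamma\cdot A_1\cdots A_n)$, $\vec\Gamma\cdot A=(\Gamma,k_0,A_1,\dots,A_n,k_n,A,0)$ with projection $(\mathsf{p}_A,\mathrm{id}_k)$ and variable $\mathsf{q}_A$. The distinguished basic type is $X\in\mathcal{U}_X(\diamond,0)$. The inclusion $I:(\mathbb{C},p)\to(\mathbb{C}_X,p_X)$ is the morphism of natural models with $I\Gamma=(\Gamma,0)$, $I\sigma=(\sigma,\mathrm{id}_0)$, $IA=A$, $Ia=a$. *)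

theory Defs
  imports "HOL-Library.FuncSet"
begin

section \<open>Small categories\<close>

record ('o, 'm) cat =
  Ob :: "'o set"
  Ar :: "'m set"
  Dom :: "'m \<Rightarrow> 'o"
  Cod :: "'m \<Rightarrow> 'o"
  Id :: "'o \<Rightarrow> 'm"
  Comp :: "'m \<Rightarrow> 'm \<Rightarrow> 'm"  \<comment> \<open>\<open>Comp C \<sigma> \<tau>\<close> is \<open>\<sigma>\<close> after \<open>\<tau>\<close>\<close>

definition Hom :: "('o, 'm, 'z) cat_scheme \<Rightarrow> 'o \<Rightarrow> 'o \<Rightarrow> 'm set" where
  "Hom C \<Delta> \<Gamma> = {\<sigma> \<in> Ar C. Dom C \<sigma> = \<Delta> \<and> Cod C \<sigma> = \<Gamma>}"

locale category =
  fixes C :: "('o, 'm, 'z) cat_scheme"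
  assumes Dom_closed: "\<sigma> \<in> Ar C \<Longrightarrow> Dom C \<sigma> \<in> Ob C"
    and Cod_closed: "\<sigma> \<in> Ar C \<Longrightarrow> Cod C \<sigma> \<in> Ob C"
    and Id_Hom: "\<Gamma> \<in> Ob C \<Longrightarrow> Id C \<Gamma> \<in> Hom C \<Gamma> \<Gamma>"
    and Comp_Hom: "\<tau> \<in> Hom C \<Theta> \<Delta> \<Longrightarrow> \<sigma> \<in> Hom C \<Delta> \<Gamma> \<Longrightarrow> Comp C \<sigma> \<tau> \<in> Hom C \<Theta> \<Gamma>"
    and Comp_Id_left: "\<sigma> \<in> Hom C \<Delta> \<Gamma> \<Longrightarrow> Comp C (Id C \<Gamma>) \<sigma> = \<sigma>"
    and Comp_Id_right: "\<sigma> \<in> Hom C \<Delta> \<Gamma> \<Longrightarrow> Comp C \<sigma> (Id C \<Delta>) = \<sigma>"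
    and Comp_assoc: "\<upsilon> \<in> Hom C \<Xi> \<Theta> \<Longrightarrow> \<tau> \<in> Hom C \<Theta> \<Delta> \<Longrightarrow> \<sigma> \<in> Hom C \<Delta> \<Gamma> \<Longrightarrow>
      Comp C (Comp C \<sigma> \<tau>) \<upsilon> = Comp C \<sigma> (Comp C \<tau> \<upsilon>)"

definition is_terminal :: "('o, 'm, 'z) cat_scheme \<Rightarrow> 'o \<Rightarrow> bool" where
  "is_terminal C T \<longleftrightarrow> T \<in> Ob C \<and> (\<forall>\<Gamma>\<in>Ob C. \<exists>!\<sigma>. \<sigma> \<in> Hom C \<Gamma> T)"


section \<open>Presheaves\<close>

record ('o, 'm, 'x) presheaf_data =
  sec :: "'o \<Rightarrow> 'x set"
  act :: "'m \<Rightarrow> 'x \<Rightarrow> 'x"  \<comment> \<open>\<open>act P \<sigma> x\<close> is \<open>x[\<sigma>]\<close>\<close>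

locale presheaf = category C
  for C :: "('o, 'm, 'z) cat_scheme" +
  fixes P :: "('o, 'm, 'x) presheaf_data"
  assumes act_closed: "\<sigma> \<in> Hom C \<Delta> \<Gamma> \<Longrightarrow> x \<in> sec P \<Gamma> \<Longrightarrow> act P \<sigma> x \<in> sec P \<Delta>"
    and act_Id: "\<Gamma> \<in> Ob C \<Longrightarrow> x \<in> sec P \<Gamma> \<Longrightarrow> act P (Id C \<Gamma>) x = x"
    and act_Comp: "\<tau> \<in> Hom C \<Theta> \<Delta> \<Longrightarrow> \<sigma> \<in> Hom C \<Delta> \<Gamma> \<Longrightarrow> x \<in> sec P \<Gamma> \<Longrightarrow>
      act P (Comp C \<sigma> \<tau>) x = act P \<tau> (act P \<sigma> x)"

definition presheaf_map :: "('o, 'm, 'z) cat_scheme \<Rightarrow> ('o, 'm, 'x) presheaf_data \<Rightarrow>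
    ('o, 'm, 'y) presheaf_data \<Rightarrow> ('o \<Rightarrow> 'x \<Rightarrow> 'y) \<Rightarrow> bool" where
  "presheaf_map C P Q \<eta> \<longleftrightarrow> presheaf C P \<and> presheaf C Q \<and>
    (\<forall>\<Gamma>\<in>Ob C. \<forall>x\<in>sec P \<Gamma>. \<eta> \<Gamma> x \<in> sec Q \<Gamma>) \<and>
    (\<forall>\<Delta> \<Gamma>. \<forall>\<sigma>\<in>Hom C \<Delta> \<Gamma>. \<forall>x\<in>sec P \<Gamma>. \<eta> \<Delta> (act P \<sigma> x) = act Q \<sigma> (\<eta> \<Gamma> x))"

definition yoneda :: "('o, 'm, 'z) cat_scheme \<Rightarrow> 'o \<Rightarrow> ('o, 'm, 'm) presheaf_data" where
  "yoneda C \<Gamma> = \<lparr>sec = (\<lambda>\<Delta>. Hom C \<Delta> \<Gamma>), act = (\<lambda>\<tau> \<sigma>. Comp C \<sigma> \<tau>)\<rparr>"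

definition yoneda_ar :: "('o, 'm, 'z) cat_scheme \<Rightarrow> 'm \<Rightarrow> 'o \<Rightarrow> 'm \<Rightarrow> 'm" where
  "yoneda_ar C \<sigma> = (\<lambda>\<Delta> \<tau>. Comp C \<sigma> \<tau>)"

text \<open>The map from a representable presheaf classified by an element of \<open>P\<close>.\<close>

definition yoneda_elt :: "('o, 'm, 'x) presheaf_data \<Rightarrow> 'x \<Rightarrow> 'o \<Rightarrow> 'm \<Rightarrow> 'x" where
  "yoneda_elt P x = (\<lambda>\<Delta> \<sigma>. act P \<sigma> x)"

text \<open>
  \<open>presheaf_pullback C P Q R S t r l b\<close> says that the square with top \<open>t\<close> from \<open>P\<close> to \<open>Q\<close>,
  right \<open>r\<close> from \<open>Q\<close> to \<open>S\<close>, left \<open>l\<close> from \<open>P\<close> to \<open>R\<close> and bottom \<open>b\<close> from \<open>R\<close> to \<open>S\<close> is a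
  pullback. Limits of presheaves are computed pointwise, so the universal property is required
  of the square of sets over each object; quantifying over all test presheaves would also
  range over all value types.
\<close>

definition presheaf_pullback :: "('o, 'm, 'z) cat_scheme \<Rightarrow>
    ('o, 'm, 'x) presheaf_data \<Rightarrow> ('o, 'm, 'y) presheaf_data \<Rightarrow>
    ('o, 'm, 'v) presheaf_data \<Rightarrow> ('o, 'm, 'w) presheaf_data \<Rightarrow>
    ('o \<Rightarrow> 'x \<Rightarrow> 'y) \<Rightarrow> ('o \<Rightarrow> 'y \<Rightarrow> 'w) \<Rightarrow> ('o \<Rightarrow> 'x \<Rightarrow> 'v) \<Rightarrow> ('o \<Rightarrow> 'v \<Rightarrow> 'w) \<Rightarrow> bool" where
  "presheaf_pullback C P Q R S t r l b \<longleftrightarrow>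
    presheaf_map C P Q t \<and> presheaf_map C Q S r \<and>
    presheaf_map C P R l \<and> presheaf_map C R S b \<and>
    (\<forall>\<Gamma>\<in>Ob C. \<forall>x\<in>sec P \<Gamma>. r \<Gamma> (t \<Gamma> x) = b \<Gamma> (l \<Gamma> x)) \<and>
    (\<forall>\<Gamma>\<in>Ob C. \<forall>y\<in>sec Q \<Gamma>. \<forall>v\<in>sec R \<Gamma>. r \<Gamma> y = b \<Gamma> v \<longrightarrow>
      (\<exists>!x. x \<in> sec P \<Gamma> \<and> t \<Gamma> x = y \<and> l \<Gamma> x = v))"


section \<open>Natural models\<close>

record ('o, 'm, 't, 'e) natmod = "('o, 'm) cat" +
  emp :: "'o"
  Ty :: "('o, 'm, 't) presheaf_data"
  Tm :: "('o, 'm, 'e) presheaf_data"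
  ty_of :: "'o \<Rightarrow> 'e \<Rightarrow> 't"
  ext :: "'o \<Rightarrow> 't \<Rightarrow> 'o"
  prj :: "'o \<Rightarrow> 't \<Rightarrow> 'm"
  var :: "'o \<Rightarrow> 't \<Rightarrow> 'e"

locale natural_model = category M
  for M :: "('o, 'm, 't, 'e) natmod" +
  assumes emp_terminal: "is_terminal M (emp M)"
    and ty_of_map: "presheaf_map M (Tm M) (Ty M) (ty_of M)"
    and ext_closed: "\<Gamma> \<in> Ob M \<Longrightarrow> A \<in> sec (Ty M) \<Gamma> \<Longrightarrow> ext M \<Gamma> A \<in> Ob M"
    and prj_Hom: "\<Gamma> \<in> Ob M \<Longrightarrow> A \<in> sec (Ty M) \<Gamma> \<Longrightarrow> prj M \<Gamma> A \<in> Hom M (ext M \<Gamma> A) \<Gamma>"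
    and var_closed: "\<Gamma> \<in> Ob M \<Longrightarrow> A \<in> sec (Ty M) \<Gamma> \<Longrightarrow> var M \<Gamma> A \<in> sec (Tm M) (ext M \<Gamma> A)"
    and representable: "\<Gamma> \<in> Ob M \<Longrightarrow> A \<in> sec (Ty M) \<Gamma> \<Longrightarrow>
      presheaf_pullback M (yoneda M (ext M \<Gamma> A)) (Tm M) (yoneda M \<Gamma>) (Ty M)
        (yoneda_elt (Tm M) (var M \<Gamma> A)) (ty_of M)
        (yoneda_ar M (prj M \<Gamma> A)) (yoneda_elt (Ty M) A)"

record ('o, 'm, 't, 'e, 'p, 'n, 'u, 'f) natmod_map =
  on_ob :: "'o \<Rightarrow> 'p"
  on_ar :: "'m \<Rightarrow> 'n"
  on_ty :: "'o \<Rightarrow> 't \<Rightarrow> 'u"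
  on_tm :: "'o \<Rightarrow> 'e \<Rightarrow> 'f"

text \<open>
  All components are extensional functions on their carriers, so that equality of the
  records is equality of morphisms.
\<close>

locale natural_model_morphism = source: natural_model M + target: natural_model N
  for M :: "('o, 'm, 't, 'e) natmod" and N :: "('p, 'n, 'u, 'f) natmod" +
  fixes F :: "('o, 'm, 't, 'e, 'p, 'n, 'u, 'f) natmod_map"
  assumes on_ob_PiE: "on_ob F \<in> Ob M \<rightarrow>\<^sub>E Ob N"
    and on_ar_PiE: "on_ar F \<in> Ar M \<rightarrow>\<^sub>E Ar N"
    and on_ty_PiE: "on_ty F \<in> (\<Pi>\<^sub>E \<Gamma>\<in>Ob M. sec (Ty M) \<Gamma> \<rightarrow>\<^sub>E sec (Ty N) (on_ob F \<Gamma>))"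
    and on_tm_PiE: "on_tm F \<in> (\<Pi>\<^sub>E \<Gamma>\<in>Ob M. sec (Tm M) \<Gamma> \<rightarrow>\<^sub>E sec (Tm N) (on_ob F \<Gamma>))"
    and on_ar_Hom: "\<sigma> \<in> Hom M \<Delta> \<Gamma> \<Longrightarrow> on_ar F \<sigma> \<in> Hom N (on_ob F \<Delta>) (on_ob F \<Gamma>)"
    and on_ar_Id: "\<Gamma> \<in> Ob M \<Longrightarrow> on_ar F (Id M \<Gamma>) = Id N (on_ob F \<Gamma>)"
    and on_ar_Comp: "\<tau> \<in> Hom M \<Theta> \<Delta> \<Longrightarrow> \<sigma> \<in> Hom M \<Delta> \<Gamma> \<Longrightarrow>
      on_ar F (Comp M \<sigma> \<tau>) = Comp N (on_ar F \<sigma>) (on_ar F \<tau>)"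
    and on_ob_emp: "on_ob F (emp M) = emp N"
    and on_ty_natural: "\<sigma> \<in> Hom M \<Delta> \<Gamma> \<Longrightarrow> A \<in> sec (Ty M) \<Gamma> \<Longrightarrow>
      on_ty F \<Delta> (act (Ty M) \<sigma> A) = act (Ty N) (on_ar F \<sigma>) (on_ty F \<Gamma> A)"
    and on_tm_natural: "\<sigma> \<in> Hom M \<Delta> \<Gamma> \<Longrightarrow> a \<in> sec (Tm M) \<Gamma> \<Longrightarrow>
      on_tm F \<Delta> (act (Tm M) \<sigma> a) = act (Tm N) (on_ar F \<sigma>) (on_tm F \<Gamma> a)"
    and ty_of_on_tm: "\<Gamma> \<in> Ob M \<Longrightarrow> a \<in> sec (Tm M) \<Gamma> \<Longrightarrow>
      ty_of N (on_ob F \<Gamma>) (on_tm F \<Gamma> a) = on_ty F \<Gamma> (ty_of M \<Gamma> a)"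
    and on_ob_ext: "\<Gamma> \<in> Ob M \<Longrightarrow> A \<in> sec (Ty M) \<Gamma> \<Longrightarrow>
      on_ob F (ext M \<Gamma> A) = ext N (on_ob F \<Gamma>) (on_ty F \<Gamma> A)"
    and on_ar_prj: "\<Gamma> \<in> Ob M \<Longrightarrow> A \<in> sec (Ty M) \<Gamma> \<Longrightarrow>
      on_ar F (prj M \<Gamma> A) = prj N (on_ob F \<Gamma>) (on_ty F \<Gamma> A)"
    and on_tm_var: "\<Gamma> \<in> Ob M \<Longrightarrow> A \<in> sec (Ty M) \<Gamma> \<Longrightarrow>
      on_tm F (ext M \<Gamma> A) (var M \<Gamma> A) = var N (on_ob F \<Gamma>) (on_ty F \<Gamma> A)"

text \<open>\<open>natmod_comp M G F\<close> is \<open>G\<close> after \<open>F\<close>, where \<open>M\<close> is the source of \<open>F\<close>.\<close>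

definition natmod_comp :: "('o, 'm, 't, 'e) natmod \<Rightarrow>
    ('p, 'n, 'u, 'f, 'q, 'k, 'v, 'g) natmod_map \<Rightarrow>
    ('o, 'm, 't, 'e, 'p, 'n, 'u, 'f) natmod_map \<Rightarrow>
    ('o, 'm, 't, 'e, 'q, 'k, 'v, 'g) natmod_map" where
  "natmod_comp M G F = \<lparr>
    on_ob = (\<lambda>\<Gamma>\<in>Ob M. on_ob G (on_ob F \<Gamma>)),
    on_ar = (\<lambda>\<sigma>\<in>Ar M. on_ar G (on_ar F \<sigma>)),
    on_ty = (\<lambda>\<Gamma>\<in>Ob M. \<lambda>A\<in>sec (Ty M) \<Gamma>. on_ty G (on_ob F \<Gamma>) (on_ty F \<Gamma> A)),
    on_tm = (\<lambda>\<Gamma>\<in>Ob M. \<lambda>a\<in>sec (Tm M) \<Gamma>. on_tm G (on_ob F \<Gamma>) (on_tm F \<Gamma> a))\<rparr>"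


section \<open>The free natural model extended by a basic type\<close>

text \<open>
  The list \<open>(\<Gamma>, k\<^sub>0, A\<^sub>1, k\<^sub>1, \<dots>, A\<^sub>n, k\<^sub>n)\<close> is encoded as
  \<open>(\<Gamma>, k\<^sub>0, [(A\<^sub>1, k\<^sub>1), \<dots>, (A\<^sub>n, k\<^sub>n)])\<close>.
\<close>

type_synonym ('o, 't) xlist = "'o \<times> nat \<times> ('t \<times> nat) list"

fun telescope :: "('o, 'm, 't, 'e) natmod \<Rightarrow> 'o \<Rightarrow> ('t \<times> nat) list \<Rightarrow> bool" where
  "telescope M \<Gamma> [] \<longleftrightarrow> True"
| "telescope M \<Gamma> ((A, k) # xs) \<longleftrightarrow> A \<in> sec (Ty M) \<Gamma> \<and> telescope M (ext M \<Gamma> A) xs"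

definition xlists :: "('o, 'm, 't, 'e) natmod \<Rightarrow> ('o, 't) xlist set" where
  "xlists M = {(\<Gamma>, k, xs). \<Gamma> \<in> Ob M \<and> telescope M \<Gamma> xs}"

inductive xident :: "('o, 'm, 't, 'e) natmod \<Rightarrow> ('o, 't) xlist \<Rightarrow> ('o, 't) xlist \<Rightarrow> bool"
  for M where
  "(\<Gamma>, 0, (A, k) # xs) \<in> xlists M \<Longrightarrow> xident M (\<Gamma>, 0, (A, k) # xs) (ext M \<Gamma> A, k, xs)"

definition xclass :: "('o, 'm, 't, 'e) natmod \<Rightarrow> ('o, 't) xlist \<Rightarrow> ('o, 't) xlist set" where
  "xclass M r = {s. equivclp (xident M) r s}"

type_synonym ('o, 't) xobj = "('o, 't) xlist set"

text \<open>
  \<open>lift f c\<close> is the value of \<open>f\<close> on any representative of the class \<open>c\<close>; it is only used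
  for functions that are constant on classes.
\<close>

definition lift :: "('a \<Rightarrow> 'b) \<Rightarrow> 'a set \<Rightarrow> 'b" where
  "lift f c = the_elem (f ` c)"

text \<open>For \<open>c = (\<Gamma>, k\<^sub>0, A\<^sub>1, k\<^sub>1, \<dots>, A\<^sub>n, k\<^sub>n)\<close>, \<open>xbase M c\<close> is \<open>\<Gamma>\<cdot>A\<^sub>1\<cdots>A\<^sub>n\<close> and
  \<open>xnum c\<close> is \<open>k\<^sub>0 + \<dots> + k\<^sub>n\<close>.\<close>

definition xbase :: "('o, 'm, 't, 'e) natmod \<Rightarrow> ('o, 't) xobj \<Rightarrow> 'o" where
  "xbase M = lift (\<lambda>(\<Gamma>, k, xs). foldl (ext M) \<Gamma> (map fst xs))"

definition xnum :: "('o, 't) xobj \<Rightarrow> nat" where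
  "xnum = lift (\<lambda>(\<Gamma>, k, xs). k + sum_list (map snd xs))"

text \<open>\<open>xarr c \<sigma> h d\<close> is \<open>(\<sigma>, h)\<close> as a morphism from \<open>c\<close> to \<open>d\<close>. The function \<open>h\<close>, from
  \<open>xnum d\<close> to \<open>xnum c\<close>, is taken to be extensional; the ordinal \<open>k\<close> is \<open>{..<k}\<close>.\<close>

datatype ('o, 'm, 't) xarr =
  XArr (xdom: "('o, 't) xobj") (xsub: 'm) (xfun: "nat \<Rightarrow> nat") (xcod: "('o, 't) xobj")

datatype 't xty = BasicTy | OldTy 't

datatype 'e xtm = BasicTm nat | OldTm 'e

fun list_ext_basic :: "('o, 't) xlist \<Rightarrow> ('o, 't) xlist" where
  "list_ext_basic (\<Gamma>, k, xs) =
    (if xs = [] then (\<Gamma>, Suc k, [])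
     else (\<Gamma>, k, butlast xs @ [(fst (last xs), Suc (snd (last xs)))]))"

fun list_ext_old :: "'t \<Rightarrow> ('o, 't) xlist \<Rightarrow> ('o, 't) xlist" where
  "list_ext_old A (\<Gamma>, k, xs) = (\<Gamma>, k, xs @ [(A, 0)])"

fun xext :: "('o, 'm, 't, 'e) natmod \<Rightarrow> ('o, 't) xobj \<Rightarrow> 't xty \<Rightarrow> ('o, 't) xobj" where
  "xext M c BasicTy = lift (\<lambda>r. xclass M (list_ext_basic r)) c"
| "xext M c (OldTy A) = lift (\<lambda>r. xclass M (list_ext_old A r)) c"

fun xprj :: "('o, 'm, 't, 'e) natmod \<Rightarrow> ('o, 't) xobj \<Rightarrow> 't xty \<Rightarrow> ('o, 'm, 't) xarr" where
  "xprj M c BasicTy =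
    XArr (xext M c BasicTy) (Id M (xbase M c)) (\<lambda>i\<in>{..<xnum c}. i) c"
| "xprj M c (OldTy A) =
    XArr (xext M c (OldTy A)) (prj M (xbase M c) A) (\<lambda>i\<in>{..<xnum c}. i) c"

fun xvar :: "('o, 'm, 't, 'e) natmod \<Rightarrow> ('o, 't) xobj \<Rightarrow> 't xty \<Rightarrow> 'e xtm" where
  "xvar M c BasicTy = BasicTm (xnum c)"
| "xvar M c (OldTy A) = OldTm (var M (xbase M c) A)"

fun xty_act :: "('o, 'm, 't, 'e) natmod \<Rightarrow> ('o, 'm, 't) xarr \<Rightarrow> 't xty \<Rightarrow> 't xty" where
  "xty_act M f BasicTy = BasicTy"
| "xty_act M f (OldTy A) = OldTy (act (Ty M) (xsub f) A)"

fun xtm_act :: "('o, 'm, 't, 'e) natmod \<Rightarrow> ('o, 'm, 't) xarr \<Rightarrow> 'e xtm \<Rightarrow> 'e xtm" where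
  "xtm_act M f (BasicTm i) = BasicTm (xfun f i)"
| "xtm_act M f (OldTm a) = OldTm (act (Tm M) (xsub f) a)"

fun xty_of :: "('o, 'm, 't, 'e) natmod \<Rightarrow> ('o, 't) xobj \<Rightarrow> 'e xtm \<Rightarrow> 't xty" where
  "xty_of M c (BasicTm i) = BasicTy"
| "xty_of M c (OldTm a) = OldTy (ty_of M (xbase M c) a)"

definition xobs :: "('o, 'm, 't, 'e) natmod \<Rightarrow> ('o, 't) xobj set" where
  "xobs M = xclass M ` xlists M"

definition free_model :: "('o, 'm, 't, 'e) natmod \<Rightarrow>
    (('o, 't) xobj, ('o, 'm, 't) xarr, 't xty, 'e xtm) natmod" where
  "free_model M = \<lparr>
    Ob = xobs M,
    Ar = {XArr c \<sigma> h d | c \<sigma> h d. c \<in> xobs M \<and> d \<in> xobs M \<and>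
            \<sigma> \<in> Hom M (xbase M c) (xbase M d) \<and> h \<in> {..<xnum d} \<rightarrow>\<^sub>E {..<xnum c}},
    Dom = xdom,
    Cod = xcod,
    Id = (\<lambda>c. XArr c (Id M (xbase M c)) (\<lambda>i\<in>{..<xnum c}. i) c),
    Comp = (\<lambda>g f. XArr (xdom f) (Comp M (xsub g) (xsub f))
              (compose {..<xnum (xcod g)} (xfun f) (xfun g)) (xcod g)),
    emp = xclass M (emp M, 0, []),
    Ty = \<lparr>sec = (\<lambda>c. {BasicTy} \<union> OldTy ` sec (Ty M) (xbase M c)), act = xty_act M\<rparr>,
    Tm = \<lparr>sec = (\<lambda>c. BasicTm ` {..<xnum c} \<union> OldTm ` sec (Tm M) (xbase M c)), act = xtm_act M\<rparr>,
    ty_of = xty_of M,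
    ext = xext M,
    prj = xprj M,
    var = xvar M\<rparr>"

definition free_inclusion :: "('o, 'm, 't, 'e) natmod \<Rightarrow>
    ('o, 'm, 't, 'e, ('o, 't) xobj, ('o, 'm, 't) xarr, 't xty, 'e xtm) natmod_map" where
  "free_inclusion M = \<lparr>
    on_ob = (\<lambda>\<Gamma>\<in>Ob M. xclass M (\<Gamma>, 0, [])),
    on_ar = (\<lambda>\<sigma>\<in>Ar M. XArr (xclass M (Dom M \<sigma>, 0, [])) \<sigma> (\<lambda>i\<in>{..<0}. i)
                         (xclass M (Cod M \<sigma>, 0, []))),
    on_ty = (\<lambda>\<Gamma>\<in>Ob M. \<lambda>A\<in>sec (Ty M) \<Gamma>. OldTy A),
    on_tm = (\<lambda>\<Gamma>\<in>Ob M. \<lambda>a\<in>sec (Tm M) \<Gamma>. OldTm a)\<rparr>"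

end

theory Submission
  imports Defs
begin

text \<open>
  An object \<open>c\<close> of the free model is generated from objects of \<open>M\<close> by extensions with the basic
  type and with old types, so its image in \<open>N\<close> is forced. Since the basic type is pulled back from
  the empty context, this image is a product of \<open>F (xbase c)\<close> with \<open>xnum c\<close> copies of the
  extension of the empty context by \<open>O_ty\<close>. A morphism \<open>(\<sigma>, h)\<close> must therefore go to the unique
  map that lies over \<open>F \<sigma>\<close> and reindexes the basic variables by \<open>h\<close>, and old types and
  terms must go to the pullbacks of their values under \<open>F\<close> along the projection to
  \<open>F (xbase c)\<close>.
\<close>

section \<open>Presheaves and natural models\<close>

text \<open>Morphisms of natural models preserve the chosen extensions on the nose, so knowing the
  image of \<open>c\<close> as a product up to isomorphism is not enough. The objects
  \<open>(\<Gamma>, 1, A, 0)\<close> and \<open>(\<Gamma>, 0, A, 1)\<close> have the same base and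
  the same number of basic variables, hence are isomorphic in the free model, yet their images
  extend \<open>F \<Gamma>\<close> in different orders. The image is therefore computed from the
  whole list, and the product property only controls the maps into it. The obstacle is the
  identification of \<open>(\<Gamma>, 0, A, ...)\<close> with
  \<open>(\<Gamma>\<cdot>A, ...)\<close>: extending \<open>F \<Gamma>\<close> by \<open>F A\<close>
  must give exactly \<open>F (\<Gamma>\<cdot>A)\<close>, with an identity as projection to the base.
  The object part is the strictness of \<open>F\<close>; the map part holds because the pairing of
  the projection and the variable of an extension is an identity.\<close>

context category
begin

lemma Hom_Ar: "\<sigma> \<in> Hom C \<Delta> \<Gamma> \<Longrightarrow> \<sigma> \<in> Ar C"
  by (simp add: Hom_def)

lemma Hom_dom: "\<sigma> \<in> Hom C \<Delta> \<Gamma> \<Longrightarrow> \<Delta> \<in> Ob C"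
  using Dom_closed by (auto simp: Hom_def)

lemma Hom_cod: "\<sigma> \<in> Hom C \<Delta> \<Gamma> \<Longrightarrow> \<Gamma> \<in> Ob C"
  using Cod_closed by (auto simp: Hom_def)

lemma presheaf_yoneda: "presheaf C (yoneda C \<Gamma>)"
  by unfold_locales (auto simp: yoneda_def Comp_Hom Comp_Id_right Comp_assoc)

lemma presheaf_map_yoneda_ar:
  "\<sigma> \<in> Hom C \<Delta> \<Gamma> \<Longrightarrow> presheaf_map C (yoneda C \<Delta>) (yoneda C \<Gamma>) (yoneda_ar C \<sigma>)"
  unfolding presheaf_map_def
  by (auto simp: presheaf_yoneda) (auto simp: yoneda_def yoneda_ar_def Comp_Hom Comp_assoc)

end

lemma (in presheaf) presheaf_map_yoneda_elt:
  "x \<in> sec P \<Gamma> \<Longrightarrow> presheaf_map C (yoneda C \<Gamma>) P (yoneda_elt P x)"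
  unfolding presheaf_map_def
  by (auto simp: presheaf_yoneda presheaf_axioms)
    (auto simp: yoneda_def yoneda_elt_def act_closed act_Comp)

section \<open>Natural models in terms of elements: terminal maps and pairings\<close>

context natural_model
begin

sublocale Ty: presheaf M "Ty M"
  using ty_of_map by (simp add: presheaf_map_def)

sublocale Tm: presheaf M "Tm M"
  using ty_of_map by (simp add: presheaf_map_def)

lemma ty_of_closed: "\<Gamma> \<in> Ob M \<Longrightarrow> a \<in> sec (Tm M) \<Gamma> \<Longrightarrow> ty_of M \<Gamma> a \<in> sec (Ty M) \<Gamma>"
  using ty_of_map by (simp add: presheaf_map_def)

lemma ty_of_natural: "\<sigma> \<in> Hom M \<Delta> \<Gamma> \<Longrightarrow> a \<in> sec (Tm M) \<Gamma> \<Longrightarrow>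
    ty_of M \<Delta> (act (Tm M) \<sigma> a) = act (Ty M) \<sigma> (ty_of M \<Gamma> a)"
  using ty_of_map by (simp add: presheaf_map_def)

lemma emp_closed: "emp M \<in> Ob M"
  using emp_terminal by (simp add: is_terminal_def)

definition bang :: "'o \<Rightarrow> 'm" where
  "bang \<Gamma> = (THE \<sigma>. \<sigma> \<in> Hom M \<Gamma> (emp M))"

lemma bang_Hom: "\<Gamma> \<in> Ob M \<Longrightarrow> bang \<Gamma> \<in> Hom M \<Gamma> (emp M)"
  unfolding bang_def using emp_terminal
  by (intro theI'[where P = "\<lambda>\<sigma>. \<sigma> \<in> Hom M \<Gamma> (emp M)"]) (simp add: is_terminal_def)

lemma bang_unique: "\<sigma> \<in> Hom M \<Gamma> (emp M) \<Longrightarrow> \<sigma> = bang \<Gamma>"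
  using emp_terminal bang_Hom Hom_dom unfolding is_terminal_def by metis

lemma Comp_bang: "\<sigma> \<in> Hom M \<Delta> \<Gamma> \<Longrightarrow> Comp M (bang \<Gamma>) \<sigma> = bang \<Delta>"
  by (meson Comp_Hom Hom_cod bang_Hom bang_unique)

text \<open>The pullback square commutes; by Yoneda it suffices to evaluate it at the identity of
  the extension, which turns it into an equation between types.\<close>

lemma ty_of_var:
  assumes "\<Gamma> \<in> Ob M" "A \<in> sec (Ty M) \<Gamma>"
  shows "ty_of M (ext M \<Gamma> A) (var M \<Gamma> A) = act (Ty M) (prj M \<Gamma> A) A"
proof -
  have "\<forall>\<Delta>\<in>Ob M. \<forall>\<sigma>\<in>Hom M \<Delta> (ext M \<Gamma> A).
      ty_of M \<Delta> (act (Tm M) \<sigma> (var M \<Gamma> A)) = act (Ty M) (Comp M (prj M \<Gamma> A) \<sigma>) A"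
    using representable[OF assms]
    by (simp add: presheaf_pullback_def yoneda_def yoneda_elt_def yoneda_ar_def)
  from this[rule_format, of "ext M \<Gamma> A" "Id M (ext M \<Gamma> A)"] show ?thesis
    using assms by (simp add: ext_closed Id_Hom Tm.act_Id var_closed Comp_Id_right[OF prj_Hom])
qed

text \<open>The pullback property at stage \<open>\<Delta>\<close>, with maps into representables
  read as substitutions. Apart from the typing of the variable, later arguments use representability
  only in this form.\<close>

lemma ex1_pairing:
  assumes "\<sigma> \<in> Hom M \<Delta> \<Gamma>" "A \<in> sec (Ty M) \<Gamma>" "a \<in> sec (Tm M) \<Delta>"
    and "ty_of M \<Delta> a = act (Ty M) \<sigma> A"
  shows "\<exists>!\<tau>. \<tau> \<in> Hom M \<Delta> (ext M \<Gamma> A) \<and> act (Tm M) \<tau> (var M \<Gamma> A) = a \<and>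
    Comp M (prj M \<Gamma> A) \<tau> = \<sigma>"
  using representable[OF Hom_cod[OF assms(1)] assms(2)] assms Hom_dom[OF assms(1)]
  by (simp add: presheaf_pullback_def yoneda_def yoneda_elt_def yoneda_ar_def)

definition pairing :: "'o \<Rightarrow> 'o \<Rightarrow> 't \<Rightarrow> 'm \<Rightarrow> 'e \<Rightarrow> 'm" where
  "pairing \<Delta> \<Gamma> A \<sigma> a = (THE \<tau>. \<tau> \<in> Hom M \<Delta> (ext M \<Gamma> A) \<and>
    act (Tm M) \<tau> (var M \<Gamma> A) = a \<and> Comp M (prj M \<Gamma> A) \<tau> = \<sigma>)"

lemma
  assumes "\<sigma> \<in> Hom M \<Delta> \<Gamma>" "A \<in> sec (Ty M) \<Gamma>" "a \<in> sec (Tm M) \<Delta>"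
    and "ty_of M \<Delta> a = act (Ty M) \<sigma> A"
  shows pairing_Hom: "pairing \<Delta> \<Gamma> A \<sigma> a \<in> Hom M \<Delta> (ext M \<Gamma> A)"
    and act_pairing_var: "act (Tm M) (pairing \<Delta> \<Gamma> A \<sigma> a) (var M \<Gamma> A) = a"
    and prj_pairing: "Comp M (prj M \<Gamma> A) (pairing \<Delta> \<Gamma> A \<sigma> a) = \<sigma>"
  using theI'[OF ex1_pairing[OF assms]] by (simp_all add: pairing_def)

text \<open>Both maps are pairings of the same data, and pairings are unique; the typing condition
  of a pairing is automatic for data that come from a map.\<close>

lemma ext_map_eqI:
  assumes "\<tau> \<in> Hom M \<Delta> (ext M \<Gamma> A)" "\<tau>' \<in> Hom M \<Delta> (ext M \<Gamma> A)" "\<Gamma> \<in> Ob M" "A \<in> sec (Ty M) \<Gamma>"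
    and "Comp M (prj M \<Gamma> A) \<tau> = Comp M (prj M \<Gamma> A) \<tau>'"
    and "act (Tm M) \<tau> (var M \<Gamma> A) = act (Tm M) \<tau>' (var M \<Gamma> A)"
  shows "\<tau> = \<tau>'"
proof -
  have "ty_of M \<Delta> (act (Tm M) \<tau> (var M \<Gamma> A)) = act (Ty M) (Comp M (prj M \<Gamma> A) \<tau>) A"
    using assms(3,4)
    by (simp add: ty_of_natural[OF assms(1)] var_closed ty_of_var Ty.act_Comp[OF assms(1) prj_Hom])
  from ex1_pairing[OF Comp_Hom[OF assms(1) prj_Hom] _ _ this] assms show ?thesis
    by (metis Tm.act_closed var_closed)
qed

end

text \<open>Yoneda turns the elementwise existence and uniqueness of pairings back into the pullback
  condition, so the free model can be checked without squares of presheaves.\<close>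

lemma natural_modelI:
  fixes M :: "('o, 'm, 't, 'e) natmod"
  assumes "category M" "is_terminal M (emp M)" "presheaf_map M (Tm M) (Ty M) (ty_of M)"
    and ext: "\<And>\<Gamma> A. \<Gamma> \<in> Ob M \<Longrightarrow> A \<in> sec (Ty M) \<Gamma> \<Longrightarrow> ext M \<Gamma> A \<in> Ob M"
    and prj: "\<And>\<Gamma> A. \<Gamma> \<in> Ob M \<Longrightarrow> A \<in> sec (Ty M) \<Gamma> \<Longrightarrow> prj M \<Gamma> A \<in> Hom M (ext M \<Gamma> A) \<Gamma>"
    and var: "\<And>\<Gamma> A. \<Gamma> \<in> Ob M \<Longrightarrow> A \<in> sec (Ty M) \<Gamma> \<Longrightarrow> var M \<Gamma> A \<in> sec (Tm M) (ext M \<Gamma> A)"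
    and ty_of_var: "\<And>\<Gamma> A. \<Gamma> \<in> Ob M \<Longrightarrow> A \<in> sec (Ty M) \<Gamma> \<Longrightarrow>
      ty_of M (ext M \<Gamma> A) (var M \<Gamma> A) = act (Ty M) (prj M \<Gamma> A) A"
    and pairing: "\<And>\<Delta> \<Gamma> \<sigma> A a. \<sigma> \<in> Hom M \<Delta> \<Gamma> \<Longrightarrow> A \<in> sec (Ty M) \<Gamma> \<Longrightarrow> a \<in> sec (Tm M) \<Delta> \<Longrightarrow>
      ty_of M \<Delta> a = act (Ty M) \<sigma> A \<Longrightarrow> \<exists>!\<tau>. \<tau> \<in> Hom M \<Delta> (ext M \<Gamma> A) \<and>
        act (Tm M) \<tau> (var M \<Gamma> A) = a \<and> Comp M (prj M \<Gamma> A) \<tau> = \<sigma>"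
  shows "natural_model M"
proof -
  interpret category M by fact
  interpret Ty: presheaf M "Ty M" using assms(3) by (simp add: presheaf_map_def)
  interpret Tm: presheaf M "Tm M" using assms(3) by (simp add: presheaf_map_def)
  have natural: "ty_of M \<Delta> (act (Tm M) \<sigma> a) = act (Ty M) \<sigma> (ty_of M \<Gamma> a)"
    if "\<sigma> \<in> Hom M \<Delta> \<Gamma>" "a \<in> sec (Tm M) \<Gamma>" for \<sigma> \<Delta> \<Gamma> a
    using assms(3) that by (simp add: presheaf_map_def)
  have "presheaf_pullback M (yoneda M (ext M \<Gamma> A)) (Tm M) (yoneda M \<Gamma>) (Ty M)
        (yoneda_elt (Tm M) (var M \<Gamma> A)) (ty_of M)
        (yoneda_ar M (prj M \<Gamma> A)) (yoneda_elt (Ty M) A)"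
    if \<Gamma>: "\<Gamma> \<in> Ob M" "A \<in> sec (Ty M) \<Gamma>" for \<Gamma> A
    unfolding presheaf_pullback_def
  proof (intro conjI ballI impI)
    show "presheaf_map M (yoneda M (ext M \<Gamma> A)) (Tm M) (yoneda_elt (Tm M) (var M \<Gamma> A))"
      by (rule Tm.presheaf_map_yoneda_elt[OF var[OF \<Gamma>]])
    show "presheaf_map M (yoneda M \<Gamma>) (Ty M) (yoneda_elt (Ty M) A)"
      by (rule Ty.presheaf_map_yoneda_elt[OF \<Gamma>(2)])
    show "presheaf_map M (yoneda M (ext M \<Gamma> A)) (yoneda M \<Gamma>) (yoneda_ar M (prj M \<Gamma> A))"
      by (rule presheaf_map_yoneda_ar[OF prj[OF \<Gamma>]])
    show "ty_of M \<Delta> (yoneda_elt (Tm M) (var M \<Gamma> A) \<Delta> \<sigma>) =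
        yoneda_elt (Ty M) A \<Delta> (yoneda_ar M (prj M \<Gamma> A) \<Delta> \<sigma>)"
      if "\<sigma> \<in> sec (yoneda M (ext M \<Gamma> A)) \<Delta>" for \<Delta> \<sigma>
      using that \<Gamma> by (simp add: yoneda_def yoneda_elt_def yoneda_ar_def natural var ty_of_var
        Ty.act_Comp[OF _ prj])
    show "\<exists>!\<tau>. \<tau> \<in> sec (yoneda M (ext M \<Gamma> A)) \<Delta> \<and> yoneda_elt (Tm M) (var M \<Gamma> A) \<Delta> \<tau> = a \<and>
        yoneda_ar M (prj M \<Gamma> A) \<Delta> \<tau> = \<sigma>"
      if "a \<in> sec (Tm M) \<Delta>" "\<sigma> \<in> sec (yoneda M \<Gamma>) \<Delta>" "ty_of M \<Delta> a = yoneda_elt (Ty M) A \<Delta> \<sigma>"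
      for \<Delta> a \<sigma>
      using that \<Gamma> pairing[of \<sigma> \<Delta> \<Gamma> A a]
      by (simp add: yoneda_def yoneda_elt_def yoneda_ar_def)
  qed (fact assms(3))
  then show ?thesis
    using assms by (intro natural_model.intro natural_model_axioms.intro)
qed

section \<open>The free model is a natural model\<close>

text \<open>Classes are generated by \<open>xident\<close>, so invariance has to be checked on
  generating pairs only. The predicate \<open>Q\<close>, itself invariant, allows \<open>f\<close>
  to be well defined on good classes only; it propagates from \<open>r\<close> to its whole
  class.\<close>

lemma lift_xclass:
  assumes "\<And>s t. xident M s t \<Longrightarrow> Q s \<longleftrightarrow> Q t"
    and "\<And>s t. xident M s t \<Longrightarrow> Q s \<Longrightarrow> Q t \<Longrightarrow> f s = f t"
    and "Q r"
  shows "lift f (xclass M r) = f r"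
proof -
  have "Q s \<and> f s = f r" if "equivclp (xident M) r s" for s
    using that
  proof (induction rule: equivclp_induct)
    case base
    then show ?case using assms(3) by simp
  next
    case (step y z)
    then show ?case using assms(1)[of y z] assms(1)[of z y] assms(2)[of y z] assms(2)[of z y] by auto
  qed
  then show ?thesis
    unfolding lift_def xclass_def
    by (intro the_elem_image_unique) (blast intro: equivclp_refl)+
qed

lemma xclass_eqI: "xident M r s \<Longrightarrow> xclass M r = xclass M s"
  unfolding xclass_def
  by (blast intro: equivclp_sym equivclp_trans)

lemma xbase_xclass [simp]: "xbase M (xclass M (\<Gamma>, k, xs)) = foldl (ext M) \<Gamma> (map fst xs)"
  unfolding xbase_def
  by (subst lift_xclass[where Q = "\<lambda>_. True"]) (auto elim!: xident.cases)

lemma xnum_xclass [simp]: "xnum (xclass M (\<Gamma>, k, xs)) = k + sum_list (map snd xs)"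
  unfolding xnum_def
  by (subst lift_xclass[where Q = "\<lambda>_. True"]) (auto elim!: xident.cases)

lemma telescope_append:
  "telescope M \<Gamma> (xs @ ys) \<longleftrightarrow> telescope M \<Gamma> xs \<and> telescope M (foldl (ext M) \<Gamma> (map fst xs)) ys"
  by (induction M \<Gamma> xs rule: telescope.induct) simp_all

lemma xext_basic_xclass:
  "xext M (xclass M r) BasicTy = xclass M (list_ext_basic r)"
  unfolding xext.simps
proof (rule lift_xclass[where Q = "\<lambda>_. True"])
  fix s t assume "xident M s t"
  then show "xclass M (list_ext_basic s) = xclass M (list_ext_basic t)"
  proof cases
    case (1 \<Gamma> A k xs)
    \<comment> \<open>If \<open>xs\<close> is empty, the number being raised is \<open>k\<close>,
      which the identification turns from the last number of a list into its initial one; this is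
      where the two branches of \<open>list_ext_basic\<close> meet. In both cases the raised list is
      still valid, so one identification step relates the results.\<close>
    have "(\<Gamma>, 0, (A, Suc k) # xs) \<in> xlists M \<and>
        (xs \<noteq> [] \<longrightarrow> (\<Gamma>, 0, (A, k) # butlast xs @ [(fst (last xs), Suc (snd (last xs)))]) \<in> xlists M)"
      using 1(3) by (cases xs rule: rev_cases) (auto simp: xlists_def telescope_append)
    then show ?thesis
      using 1 by (auto intro!: xclass_eqI xident.intros)
  qed
qed auto

lemma xext_old_xclass:
  assumes "A \<in> sec (Ty M) (foldl (ext M) \<Gamma> (map fst xs))"
  shows "xext M (xclass M (\<Gamma>, k, xs)) (OldTy A) = xclass M (\<Gamma>, k, xs @ [(A, 0)])"
  unfolding xext.simps
\<comment> \<open>Appending \<open>A\<close> yields a valid list, as \<open>xident\<close> demands,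
  only if \<open>A\<close> is a type over the base. Both sides of an identification have the same
  base, so this condition can serve as the invariant.\<close>
proof (subst lift_xclass[where Q = "\<lambda>(\<Gamma>, k, xs). A \<in> sec (Ty M) (foldl (ext M) \<Gamma> (map fst xs))"])
  fix s t
  assume "xident M s t" "case s of (\<Gamma>, k, xs) \<Rightarrow> A \<in> sec (Ty M) (foldl (ext M) \<Gamma> (map fst xs))"
  then show "xclass M (list_ext_old A s) = xclass M (list_ext_old A t)"
    by (auto elim!: xident.cases intro!: xclass_eqI xident.intros simp: xlists_def telescope_append)
qed (use assms in \<open>auto elim!: xident.cases\<close>)

lemma xobs_cases:
  assumes "c \<in> xobs M"
  obtains \<Gamma> k xs where "c = xclass M (\<Gamma>, k, xs)" "\<Gamma> \<in> Ob M" "telescope M \<Gamma> xs"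
  using assms by (auto simp: xobs_def xlists_def)

lemma xclass_in_xobs: "\<Gamma> \<in> Ob M \<Longrightarrow> telescope M \<Gamma> xs \<Longrightarrow> xclass M (\<Gamma>, k, xs) \<in> xobs M"
  by (auto simp: xobs_def xlists_def)

lemma xext_basic:
  assumes "c \<in> xobs M"
  shows "xext M c BasicTy \<in> xobs M"
    and "xbase M (xext M c BasicTy) = xbase M c"
    and "xnum (xext M c BasicTy) = Suc (xnum c)"
proof -
  from assms obtain \<Gamma> k xs where c: "c = xclass M (\<Gamma>, k, xs)" "\<Gamma> \<in> Ob M" "telescope M \<Gamma> xs"
    by (rule xobs_cases)
  show "xext M c BasicTy \<in> xobs M" "xbase M (xext M c BasicTy) = xbase M c"
    "xnum (xext M c BasicTy) = Suc (xnum c)"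
    using c by (cases xs rule: rev_cases;
        auto simp: xext_basic_xclass telescope_append intro!: xclass_in_xobs simp del: xext.simps)+
qed

lemma xext_old:
  assumes "c \<in> xobs M" "A \<in> sec (Ty M) (xbase M c)"
  shows "xext M c (OldTy A) \<in> xobs M"
    and "xbase M (xext M c (OldTy A)) = ext M (xbase M c) A"
    and "xnum (xext M c (OldTy A)) = xnum c"
proof -
  from assms(1) obtain \<Gamma> k xs where c: "c = xclass M (\<Gamma>, k, xs)" "\<Gamma> \<in> Ob M" "telescope M \<Gamma> xs"
    by (rule xobs_cases)
  show "xext M c (OldTy A) \<in> xobs M" "xbase M (xext M c (OldTy A)) = ext M (xbase M c) A"
    "xnum (xext M c (OldTy A)) = xnum c"
    using c assms(2)
    by (auto simp: xext_old_xclass telescope_append intro!: xclass_in_xobs simp del: xext.simps)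
qed

declare xext.simps [simp del]

text \<open>Read from left to right, a list is built by raising its last number and by appending a
  type with number 0. Different constructions may end in the same class, so the rule supports
  proofs, whereas recursive definitions have to start from lists.\<close>

lemma xobs_induct [consumes 1, case_names incl basic old]:
  assumes "c \<in> xobs M"
    and incl: "\<And>\<Gamma>. \<Gamma> \<in> Ob M \<Longrightarrow> P (xclass M (\<Gamma>, 0, []))"
    and basic: "\<And>c. c \<in> xobs M \<Longrightarrow> P c \<Longrightarrow> P (xext M c BasicTy)"
    and old: "\<And>c A. c \<in> xobs M \<Longrightarrow> A \<in> sec (Ty M) (xbase M c) \<Longrightarrow> P c \<Longrightarrow> P (xext M c (OldTy A))"
  shows "P c"
proof -
  have nil: "P (xclass M (\<Gamma>, k, []))" if "\<Gamma> \<in> Ob M" for \<Gamma> k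
  proof (induction k)
    case 0
    show ?case by (rule incl[OF that])
  next
    case (Suc k)
    from basic[OF xclass_in_xobs[OF that] this] show ?case
      by (simp add: xext_basic_xclass)
  qed
  have "P (xclass M (\<Gamma>, k, xs))" if "\<Gamma> \<in> Ob M" "telescope M \<Gamma> xs" for \<Gamma> k xs
    using that(2)
  proof (induction xs rule: rev_induct)
    case Nil
    show ?case by (rule nil[OF that(1)])
  next
    case (snoc x xs)
    obtain A j where x: "x = (A, j)" by (cases x)
    have A: "A \<in> sec (Ty M) (foldl (ext M) \<Gamma> (map fst xs))" "telescope M \<Gamma> xs"
      using snoc.prems by (auto simp: x telescope_append)
    have "P (xclass M (\<Gamma>, k, xs @ [(A, j)]))"
    proof (induction j)
      case 0
      from old[OF xclass_in_xobs[OF that(1) A(2)] _ snoc.IH[OF A(2)], of A] show ?case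
        using A by (simp add: xext_old_xclass)
    next
      case (Suc j)
      from basic[OF xclass_in_xobs[OF that(1)] this] show ?case
        using A by (simp add: xext_basic_xclass telescope_append)
    qed
    then show ?case by (simp add: x)
  qed
  then show ?thesis
    using assms(1) by (auto elim: xobs_cases)
qed

section \<open>Morphisms, presheaves and pairings of the free model\<close>

lemma free_model_simps [simp]:
  "Ob (free_model M) = xobs M"
  "Dom (free_model M) = xdom"
  "Cod (free_model M) = xcod"
  "Id (free_model M) c = XArr c (Id M (xbase M c)) (\<lambda>i\<in>{..<xnum c}. i) c"
  "Comp (free_model M) g f = XArr (xdom f) (Comp M (xsub g) (xsub f))
     (compose {..<xnum (xcod g)} (xfun f) (xfun g)) (xcod g)"
  "emp (free_model M) = xclass M (emp M, 0, [])"
  "sec (Ty (free_model M)) c = {BasicTy} \<union> OldTy ` sec (Ty M) (xbase M c)"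
  "act (Ty (free_model M)) = xty_act M"
  "sec (Tm (free_model M)) c = BasicTm ` {..<xnum c} \<union> OldTm ` sec (Tm M) (xbase M c)"
  "act (Tm (free_model M)) = xtm_act M"
  "ty_of (free_model M) = xty_of M"
  "ext (free_model M) = xext M"
  "prj (free_model M) = xprj M"
  "var (free_model M) = xvar M"
  by (simp_all add: free_model_def)

lemma XArr_Ar_iff:
  "XArr c \<sigma> h d \<in> Ar (free_model M) \<longleftrightarrow> c \<in> xobs M \<and> d \<in> xobs M \<and>
    \<sigma> \<in> Hom M (xbase M c) (xbase M d) \<and> h \<in> {..<xnum d} \<rightarrow>\<^sub>E {..<xnum c}"
  by (simp add: free_model_def)

lemma Hom_free_model:
  "f \<in> Hom (free_model M) c d \<longleftrightarrow> (\<exists>\<sigma> h. f = XArr c \<sigma> h d \<and> c \<in> xobs M \<and> d \<in> xobs M \<and>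
    \<sigma> \<in> Hom M (xbase M c) (xbase M d) \<and> h \<in> {..<xnum d} \<rightarrow>\<^sub>E {..<xnum c})"
  by (cases f) (auto simp: Hom_def[of "free_model M"] XArr_Ar_iff)

lemma XArr_Hom_iff:
  "XArr c' \<sigma> h d' \<in> Hom (free_model M) c d \<longleftrightarrow> c' = c \<and> d' = d \<and> c \<in> xobs M \<and> d \<in> xobs M \<and>
    \<sigma> \<in> Hom M (xbase M c) (xbase M d) \<and> h \<in> {..<xnum d} \<rightarrow>\<^sub>E {..<xnum c}"
  by (simp add: Hom_free_model)

lemma Hom_free_modelD:
  assumes "f \<in> Hom (free_model M) c d"
  shows "xdom f = c" "xcod f = d" "c \<in> xobs M" "d \<in> xobs M"
    and "xsub f \<in> Hom M (xbase M c) (xbase M d)"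
    and "xfun f \<in> {..<xnum d} \<rightarrow>\<^sub>E {..<xnum c}"
proof -
  obtain \<sigma> h where "f = XArr c \<sigma> h d" "c \<in> xobs M" "d \<in> xobs M"
    "\<sigma> \<in> Hom M (xbase M c) (xbase M d)" "h \<in> {..<xnum d} \<rightarrow>\<^sub>E {..<xnum c}"
    using assms unfolding Hom_free_model by blast
  then show "xdom f = c" "xcod f = d" "c \<in> xobs M" "d \<in> xobs M"
    "xsub f \<in> Hom M (xbase M c) (xbase M d)" "xfun f \<in> {..<xnum d} \<rightarrow>\<^sub>E {..<xnum c}"
    by simp_all
qed

lemma xty_of_natural:
  assumes "natural_model M" "f \<in> Hom (free_model M) c d" "a \<in> sec (Tm (free_model M)) d"
  shows "xty_of M c (xtm_act M f a) = xty_act M f (xty_of M d a)"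
  using assms natural_model.ty_of_natural[OF assms(1)] by (auto simp: Hom_free_model)

context natural_model
begin

lemma xbase_closed: "c \<in> xobs M \<Longrightarrow> xbase M c \<in> Ob M"
  by (induction rule: xobs_induct) (simp_all add: xext_basic xext_old ext_closed)

lemma xobs_incl: "\<Gamma> \<in> Ob M \<Longrightarrow> xclass M (\<Gamma>, 0, []) \<in> xobs M"
  by (simp add: xclass_in_xobs)

lemma category_free_model: "category (free_model M)"
proof
  fix \<sigma> assume "\<sigma> \<in> Ar (free_model M)"
  then show "Dom (free_model M) \<sigma> \<in> Ob (free_model M)" "Cod (free_model M) \<sigma> \<in> Ob (free_model M)"
    by (cases \<sigma>; simp add: XArr_Ar_iff)+
next
  fix c assume "c \<in> Ob (free_model M)"
  then show "Id (free_model M) c \<in> Hom (free_model M) c c"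
    by (auto simp: XArr_Hom_iff Id_Hom xbase_closed)
next
  fix \<tau> \<Theta> \<Delta> \<sigma> \<Gamma> assume "\<tau> \<in> Hom (free_model M) \<Theta> \<Delta>" "\<sigma> \<in> Hom (free_model M) \<Delta> \<Gamma>"
  then show "Comp (free_model M) \<sigma> \<tau> \<in> Hom (free_model M) \<Theta> \<Gamma>"
    by (auto simp: Hom_free_model intro: Comp_Hom) (auto simp: compose_def)
next
  fix \<sigma> \<Delta> \<Gamma> assume "\<sigma> \<in> Hom (free_model M) \<Delta> \<Gamma>"
  then show "Comp (free_model M) (Id (free_model M) \<Gamma>) \<sigma> = \<sigma>"
    "Comp (free_model M) \<sigma> (Id (free_model M) \<Delta>) = \<sigma>"
    by (auto simp: Hom_free_model Comp_Id_left Comp_Id_right fun_eq_iff compose_def PiE_iff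
        extensional_def)
next
  fix \<upsilon> \<Xi> \<Theta> \<tau> \<Delta> \<sigma> \<Gamma>
  assume "\<upsilon> \<in> Hom (free_model M) \<Xi> \<Theta>" "\<tau> \<in> Hom (free_model M) \<Theta> \<Delta>"
    "\<sigma> \<in> Hom (free_model M) \<Delta> \<Gamma>"
  then show "Comp (free_model M) (Comp (free_model M) \<sigma> \<tau>) \<upsilon> =
      Comp (free_model M) \<sigma> (Comp (free_model M) \<tau> \<upsilon>)"
    by (auto simp: Hom_free_model Comp_assoc fun_eq_iff compose_def PiE_iff)
qed

lemma presheaf_Ty_free_model: "presheaf (free_model M) (Ty (free_model M))"
proof (intro presheaf.intro category_free_model presheaf_axioms.intro)
qed (auto simp: Hom_free_model Ty.act_closed Ty.act_Id Ty.act_Comp xbase_closed)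

lemma presheaf_Tm_free_model: "presheaf (free_model M) (Tm (free_model M))"
proof (intro presheaf.intro category_free_model presheaf_axioms.intro)
qed (auto simp: Hom_free_model Tm.act_closed Tm.act_Id Tm.act_Comp xbase_closed compose_def)

text \<open>A term of basic type is an index \<open>i\<close>, so the pairing keeps
  \<open>\<sigma>\<close> and extends the finite function by sending the new index
  \<open>xnum d\<close> to \<open>i\<close>.\<close>

lemma xpairing_basic:
  assumes "f \<in> Hom (free_model M) c d" "i < xnum c"
  shows "\<exists>!g. g \<in> Hom (free_model M) c (xext M d BasicTy) \<and>
    xtm_act M g (BasicTm (xnum d)) = BasicTm i \<and> Comp (free_model M) (xprj M d BasicTy) g = f"
proof -
  from assms obtain \<sigma> h where f: "f = XArr c \<sigma> h d" "c \<in> xobs M" "d \<in> xobs M"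
      "\<sigma> \<in> Hom M (xbase M c) (xbase M d)" "h \<in> {..<xnum d} \<rightarrow>\<^sub>E {..<xnum c}"
    by (auto simp: Hom_free_model)
  show ?thesis
  proof (rule ex1I[of _ "XArr c \<sigma> (h(xnum d := i)) (xext M d BasicTy)"])
    show "XArr c \<sigma> (h(xnum d := i)) (xext M d BasicTy) \<in> Hom (free_model M) c (xext M d BasicTy) \<and>
      xtm_act M (XArr c \<sigma> (h(xnum d := i)) (xext M d BasicTy)) (BasicTm (xnum d)) = BasicTm i \<and>
      Comp (free_model M) (xprj M d BasicTy) (XArr c \<sigma> (h(xnum d := i)) (xext M d BasicTy)) = f"
      using f assms(2)
      by (auto simp: XArr_Hom_iff xext_basic Comp_Id_left PiE_iff extensional_def compose_def
          fun_eq_iff)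
  next
    fix g
    assume g: "g \<in> Hom (free_model M) c (xext M d BasicTy) \<and>
      xtm_act M g (BasicTm (xnum d)) = BasicTm i \<and> Comp (free_model M) (xprj M d BasicTy) g = f"
    then obtain \<tau> h' where g': "g = XArr c \<tau> h' (xext M d BasicTy)"
        "\<tau> \<in> Hom M (xbase M c) (xbase M d)" "h' \<in> {..<Suc (xnum d)} \<rightarrow>\<^sub>E {..<xnum c}"
      using f by (auto simp: Hom_free_model xext_basic)
    \<comment> \<open>The projection fixes the values below \<open>xnum d\<close> and the variable
      fixes the value at \<open>xnum d\<close>; beyond it both functions are
      \<open>undefined\<close> by extensionality.\<close>
    have "h' j = (h(xnum d := i)) j" for j
    proof (cases "j < xnum d")
      case True
      have "compose {..<xnum d} h' (\<lambda>i\<in>{..<xnum d}. i) = h"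
        using g g' f by simp
      from fun_cong[OF this, of j] True show ?thesis
        by (simp add: compose_def)
    next
      case False
      then show ?thesis
        using g g' f by (cases "j = xnum d") (auto simp: PiE_iff extensional_def)
    qed
    then show "g = XArr c \<sigma> (h(xnum d := i)) (xext M d BasicTy)"
      using g g' f by (auto simp: Comp_Id_left)
  qed
qed

text \<open>Extension by an old type adds no index, so the finite function stays as it is and the
  pairing takes place in \<open>M\<close> alone.\<close>

lemma xpairing_old:
  assumes "f \<in> Hom (free_model M) c d" "A \<in> sec (Ty M) (xbase M d)" "a \<in> sec (Tm M) (xbase M c)"
    and "ty_of M (xbase M c) a = act (Ty M) (xsub f) A"
  shows "\<exists>!g. g \<in> Hom (free_model M) c (xext M d (OldTy A)) \<and>
    xtm_act M g (xvar M d (OldTy A)) = OldTm a \<and> Comp (free_model M) (xprj M d (OldTy A)) g = f"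
proof -
  from assms obtain \<sigma> h where f: "f = XArr c \<sigma> h d" "c \<in> xobs M" "d \<in> xobs M"
      "\<sigma> \<in> Hom M (xbase M c) (xbase M d)" "h \<in> {..<xnum d} \<rightarrow>\<^sub>E {..<xnum c}"
    by (auto simp: Hom_free_model)
  have ty: "ty_of M (xbase M c) a = act (Ty M) \<sigma> A"
    using assms(4) f by simp
  note p = f(4) assms(2,3) ty
  let ?\<tau> = "pairing (xbase M c) (xbase M d) A \<sigma> a"
  have restrict_h: "compose {..<xnum d} h' (\<lambda>i\<in>{..<xnum d}. i) = h'"
    if "h' \<in> {..<xnum d} \<rightarrow>\<^sub>E {..<xnum c}" for h'
    using that by (auto simp: PiE_iff extensional_def compose_def fun_eq_iff)
  show ?thesis
  proof (rule ex1I[of _ "XArr c ?\<tau> h (xext M d (OldTy A))"])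
    show "XArr c ?\<tau> h (xext M d (OldTy A)) \<in> Hom (free_model M) c (xext M d (OldTy A)) \<and>
      xtm_act M (XArr c ?\<tau> h (xext M d (OldTy A))) (xvar M d (OldTy A)) = OldTm a \<and>
      Comp (free_model M) (xprj M d (OldTy A)) (XArr c ?\<tau> h (xext M d (OldTy A))) = f"
      using f assms(2) pairing_Hom[OF p] act_pairing_var[OF p] prj_pairing[OF p]
      by (simp add: XArr_Hom_iff xext_old restrict_h)
  next
    fix g
    assume g: "g \<in> Hom (free_model M) c (xext M d (OldTy A)) \<and>
      xtm_act M g (xvar M d (OldTy A)) = OldTm a \<and> Comp (free_model M) (xprj M d (OldTy A)) g = f"
    then obtain \<tau> h' where g': "g = XArr c \<tau> h' (xext M d (OldTy A))"
        "\<tau> \<in> Hom M (xbase M c) (ext M (xbase M d) A)" "h' \<in> {..<xnum d} \<rightarrow>\<^sub>E {..<xnum c}"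
      using f assms(2) by (auto simp: Hom_free_model xext_old)
    have "h' = h" "Comp M (prj M (xbase M d) A) \<tau> = \<sigma>"
      "act (Tm M) \<tau> (var M (xbase M d) A) = a"
      using g g'(1) f restrict_h[OF g'(3)] by simp_all
    moreover from this have "\<tau> = ?\<tau>"
      using ex1_pairing[OF p] pairing_Hom[OF p] act_pairing_var[OF p] prj_pairing[OF p] g'(2)
      by blast
    ultimately show "g = XArr c ?\<tau> h (xext M d (OldTy A))"
      by (simp add: g'(1))
  qed
qed

lemma natural_model_free_model: "natural_model (free_model M)"
proof (rule natural_modelI)
  show "is_terminal (free_model M) (emp (free_model M))"
    unfolding is_terminal_def
  proof (intro conjI ballI)
    show "emp (free_model M) \<in> Ob (free_model M)"
      by (simp add: xobs_incl emp_closed)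
    fix c assume c: "c \<in> Ob (free_model M)"
    show "\<exists>!f. f \<in> Hom (free_model M) c (emp (free_model M))"
    \<comment> \<open>The distinguished list has base \<open>emp M\<close> and no indices, so only
      the map to \<open>emp M\<close> and the empty function remain.\<close>
    proof (rule ex1I[of _ "XArr c (bang (xbase M c)) (\<lambda>i\<in>{..<0}. i) (emp (free_model M))"])
      show "XArr c (bang (xbase M c)) (\<lambda>i\<in>{..<0}. i) (emp (free_model M))
          \<in> Hom (free_model M) c (emp (free_model M))"
        using c by (simp add: XArr_Hom_iff xobs_incl emp_closed bang_Hom xbase_closed restrict_def)
    next
      fix f assume "f \<in> Hom (free_model M) c (emp (free_model M))"
      then show "f = XArr c (bang (xbase M c)) (\<lambda>i\<in>{..<0}. i) (emp (free_model M))"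
        by (auto simp: Hom_free_model dest: bang_unique)
    qed
  qed
  show "presheaf_map (free_model M) (Tm (free_model M)) (Ty (free_model M)) (ty_of (free_model M))"
    unfolding presheaf_map_def
    using presheaf_Ty_free_model presheaf_Tm_free_model xty_of_natural[OF natural_model_axioms]
    by (auto simp: ty_of_closed xbase_closed)
next
  fix d B assume "d \<in> Ob (free_model M)" "B \<in> sec (Ty (free_model M)) d"
  then show "ext (free_model M) d B \<in> Ob (free_model M)"
    "prj (free_model M) d B \<in> Hom (free_model M) (ext (free_model M) d B) d"
    "var (free_model M) d B \<in> sec (Tm (free_model M)) (ext (free_model M) d B)"
    "ty_of (free_model M) (ext (free_model M) d B) (var (free_model M) d B) =
      act (Ty (free_model M)) (prj (free_model M) d B) B"
    by (auto simp: xext_basic xext_old XArr_Hom_iff Id_Hom prj_Hom var_closed xbase_closed ty_of_var)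
next
  fix c d f B a
  assume "f \<in> Hom (free_model M) c d" "B \<in> sec (Ty (free_model M)) d"
    "a \<in> sec (Tm (free_model M)) c"
    "ty_of (free_model M) c a = act (Ty (free_model M)) f B"
  then show "\<exists>!g. g \<in> Hom (free_model M) c (ext (free_model M) d B) \<and>
      act (Tm (free_model M)) g (var (free_model M) d B) = a \<and>
      Comp (free_model M) (prj (free_model M) d B) g = f"
  proof (cases B)
    case BasicTy
    with \<open>a \<in> _\<close> \<open>ty_of _ _ _ = _\<close> obtain i where "a = BasicTm i" "i < xnum c"
      by auto
    with xpairing_basic[OF \<open>f \<in> _\<close>, of i] BasicTy show ?thesis
      by (simp only: free_model_simps(10,12-14) xvar.simps(1))
  next
    case (OldTy A)
    with \<open>a \<in> _\<close> \<open>ty_of _ _ _ = _\<close> obtain a' where "a = OldTm a'" "a' \<in> sec (Tm M) (xbase M c)"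
        "ty_of M (xbase M c) a' = act (Ty M) (xsub f) A"
      by auto
    moreover have "A \<in> sec (Ty M) (xbase M d)"
      using \<open>B \<in> _\<close> OldTy by auto
    ultimately show ?thesis
      using xpairing_old[OF \<open>f \<in> _\<close>, of A a'] OldTy by (simp only: free_model_simps(10,12-14))
  qed
qed (rule category_free_model)

end

section \<open>The extension of a morphism to the free model\<close>

locale free_extension = natural_model_morphism M N F
  for M :: "('o, 'm, 't, 'e) natmod" and N :: "('p, 'n, 'u, 'f) natmod"
    and F :: "('o, 'm, 't, 'e, 'p, 'n, 'u, 'f) natmod_map" +
  fixes O_ty :: 'u
  assumes O_ty_closed: "O_ty \<in> sec (Ty N) (emp N)"
begin

lemma on_ob_closed: "\<Gamma> \<in> Ob M \<Longrightarrow> on_ob F \<Gamma> \<in> Ob N"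
  using on_ob_PiE by auto

lemma on_ty_closed: "\<Gamma> \<in> Ob M \<Longrightarrow> A \<in> sec (Ty M) \<Gamma> \<Longrightarrow> on_ty F \<Gamma> A \<in> sec (Ty N) (on_ob F \<Gamma>)"
  using on_ty_PiE by (auto simp: PiE_iff)

lemma on_tm_closed: "\<Gamma> \<in> Ob M \<Longrightarrow> a \<in> sec (Tm M) \<Gamma> \<Longrightarrow> on_tm F \<Gamma> a \<in> sec (Tm N) (on_ob F \<Gamma>)"
  using on_tm_PiE by (auto simp: PiE_iff)

definition basic_ty :: "'p \<Rightarrow> 'u" where
  "basic_ty P = act (Ty N) (target.bang P) O_ty"

lemma basic_ty_closed: "P \<in> Ob N \<Longrightarrow> basic_ty P \<in> sec (Ty N) P"
  unfolding basic_ty_def using O_ty_closed target.Ty.act_closed target.bang_Hom by blast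

text \<open>Any composite into \<open>emp N\<close> is the unique such map. This stability is what
  lets basic variables be moved along arbitrary maps of \<open>N\<close> and remain basic
  variables.\<close>

lemma act_basic_ty: "\<sigma> \<in> Hom N Q P \<Longrightarrow> act (Ty N) \<sigma> (basic_ty P) = basic_ty Q"
  unfolding basic_ty_def using O_ty_closed
  by (metis target.Comp_bang target.Hom_cod target.Ty.act_Comp target.bang_Hom)

text \<open>
  A list \<open>(\<Gamma>, k\<^sub>0, A\<^sub>1, \<dots>, A\<^sub>n, k\<^sub>n)\<close> is interpreted from left to right. A state
  \<open>(\<Gamma>, P, b, vs)\<close> consists of the base reached so far, its image \<open>P\<close> in \<open>N\<close>, the projection
  \<open>b\<close> from \<open>P\<close> to \<open>F \<Gamma>\<close> that forgets the basic variables, and those variables themselves.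
\<close>

fun init :: "'o \<Rightarrow> 'o \<times> 'p \<times> 'n \<times> 'f list" where
  "init \<Gamma> = (\<Gamma>, on_ob F \<Gamma>, Id N (on_ob F \<Gamma>), [])"

fun add_basic :: "'o \<times> 'p \<times> 'n \<times> 'f list \<Rightarrow> 'o \<times> 'p \<times> 'n \<times> 'f list" where
  "add_basic (\<Gamma>, P, b, vs) = (\<Gamma>, ext N P (basic_ty P), Comp N b (prj N P (basic_ty P)),
    map (act (Tm N) (prj N P (basic_ty P))) vs @ [var N P (basic_ty P)])"

text \<open>The old type is pulled back along \<open>b\<close> before \<open>P\<close> is extended
  by it. The new projection to the base is the canonical lift of \<open>b\<close> to the extensions,
  the map that exhibits the extension of \<open>P\<close> as a pullback of the extension of
  \<open>F \<Gamma>\<close>. The variables are merely weakened, as no basic variable is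
  added.\<close>

fun add_old :: "'t \<Rightarrow> 'o \<times> 'p \<times> 'n \<times> 'f list \<Rightarrow> 'o \<times> 'p \<times> 'n \<times> 'f list" where
  "add_old A (\<Gamma>, P, b, vs) = (let B = act (Ty N) b (on_ty F \<Gamma> A) in
    (ext M \<Gamma> A, ext N P B,
     target.pairing (ext N P B) (on_ob F \<Gamma>) (on_ty F \<Gamma> A) (Comp N b (prj N P B)) (var N P B),
     map (act (Tm N) (prj N P B)) vs))"

fun interp :: "('o, 't) xlist \<Rightarrow> 'o \<times> 'p \<times> 'n \<times> 'f list" where
  "interp (\<Gamma>, k, xs) =
    foldl (\<lambda>s (A, k). (add_basic ^^ k) (add_old A s)) ((add_basic ^^ k) (init \<Gamma>)) xs"

text \<open>This is why the interpretation respects the identification of lists: without basic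
  variables the projection to the base is an identity, it lifts to an identity on the extension by
  uniqueness of pairings, and \<open>F\<close> preserves extensions strictly.\<close>

lemma add_old_init:
  assumes "\<Gamma> \<in> Ob M" "A \<in> sec (Ty M) \<Gamma>"
  shows "add_old A (init \<Gamma>) = init (ext M \<Gamma> A)"
proof -
  let ?P = "on_ob F \<Gamma>" and ?B = "on_ty F \<Gamma> A"
  note P = on_ob_closed[OF assms(1)] on_ty_closed[OF assms]
  note p = target.prj_Hom[OF P] P(2) target.var_closed[OF P] target.ty_of_var[OF P]
  have "target.pairing (ext N ?P ?B) ?P ?B (prj N ?P ?B) (var N ?P ?B) = Id N (ext N ?P ?B)"
    using P target.ext_closed[OF P]
    by (intro target.ext_map_eqI[OF target.pairing_Hom[OF p] target.Id_Hom P])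
      (simp_all add: target.prj_pairing[OF p] target.act_pairing_var[OF p]
        target.Comp_Id_right[OF target.prj_Hom] target.Tm.act_Id target.var_closed)
  with assms P show ?thesis
    by (simp add: target.Ty.act_Id target.Comp_Id_left[OF target.prj_Hom] on_ob_ext Let_def)
qed

definition state :: "('o, 't) xobj \<Rightarrow> 'o \<times> 'p \<times> 'n \<times> 'f list" where
  "state = lift interp"

lemma state_xclass: "state (xclass M r) = interp r"
  unfolding state_def
proof (rule lift_xclass[where Q = "\<lambda>_. True"])
  fix s t assume "xident M s t"
  then show "interp s = interp t"
    by cases (auto simp: xlists_def add_old_init simp del: init.simps add_old.simps)
qed auto

lemma state_incl: "state (xclass M (\<Gamma>, 0, [])) = init \<Gamma>"
  by (simp add: state_xclass)

lemma state_basic: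
  assumes "c \<in> xobs M"
  shows "state (xext M c BasicTy) = add_basic (state c)"
proof -
  from assms obtain \<Gamma> k xs where "c = xclass M (\<Gamma>, k, xs)" by (rule xobs_cases)
  then show ?thesis
    by (cases xs rule: rev_cases) (auto simp: xext_basic_xclass state_xclass split: prod.split)
qed

lemma state_old:
  assumes "c \<in> xobs M" "A \<in> sec (Ty M) (xbase M c)"
  shows "state (xext M c (OldTy A)) = add_old A (state c)"
proof -
  from assms(1) obtain \<Gamma> k xs where "c = xclass M (\<Gamma>, k, xs)" by (rule xobs_cases)
  with assms(2) show ?thesis
    by (simp add: xext_old_xclass state_xclass)
qed

lemma fst_state: "c \<in> xobs M \<Longrightarrow> fst (state c) = xbase M c"
proof (induction rule: xobs_induct)
  case (basic c)
  then show ?case by (cases "state c") (simp add: state_basic xext_basic)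
next
  case (old c A)
  then show ?case by (cases "state c") (simp add: state_old xext_old Let_def)
qed (simp add: state_incl)

section \<open>Image, projection to the base and basic variables of an object\<close>

definition img :: "('o, 't) xobj \<Rightarrow> 'p" where
  "img c = fst (snd (state c))"

definition base_map :: "('o, 't) xobj \<Rightarrow> 'n" where
  "base_map c = fst (snd (snd (state c)))"

definition vars :: "('o, 't) xobj \<Rightarrow> 'f list" where
  "vars c = snd (snd (snd (state c)))"

definition old_ty :: "('o, 't) xobj \<Rightarrow> 't \<Rightarrow> 'u" where
  "old_ty c A = act (Ty N) (base_map c) (on_ty F (xbase M c) A)"

lemma
  shows img_incl: "img (xclass M (\<Gamma>, 0, [])) = on_ob F \<Gamma>"
    and base_map_incl: "base_map (xclass M (\<Gamma>, 0, [])) = Id N (on_ob F \<Gamma>)"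
    and vars_incl: "vars (xclass M (\<Gamma>, 0, [])) = []"
  by (simp_all add: img_def base_map_def vars_def state_incl)

lemma
  assumes "c \<in> xobs M"
  shows img_basic: "img (xext M c BasicTy) = ext N (img c) (basic_ty (img c))"
    and base_map_basic: "base_map (xext M c BasicTy) =
      Comp N (base_map c) (prj N (img c) (basic_ty (img c)))"
    and vars_basic: "vars (xext M c BasicTy) =
      map (act (Tm N) (prj N (img c) (basic_ty (img c)))) (vars c) @ [var N (img c) (basic_ty (img c))]"
  by (cases "state c"; simp add: img_def base_map_def vars_def state_basic[OF assms])+

lemma
  assumes "c \<in> xobs M" "A \<in> sec (Ty M) (xbase M c)"
  shows img_old: "img (xext M c (OldTy A)) = ext N (img c) (old_ty c A)"
    and base_map_old: "base_map (xext M c (OldTy A)) =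
      target.pairing (ext N (img c) (old_ty c A)) (on_ob F (xbase M c)) (on_ty F (xbase M c) A)
        (Comp N (base_map c) (prj N (img c) (old_ty c A))) (var N (img c) (old_ty c A))"
    and vars_old: "vars (xext M c (OldTy A)) =
      map (act (Tm N) (prj N (img c) (old_ty c A))) (vars c)"
  using fst_state[OF assms(1)]
  by (cases "state c";
      simp add: img_def base_map_def vars_def old_ty_def state_old[OF assms] Let_def)+

definition basic_tms :: "'p \<Rightarrow> 'f set" where
  "basic_tms P = {a \<in> sec (Tm N) P. ty_of N P a = basic_ty P}"

lemma act_basic_tms: "\<sigma> \<in> Hom N Q P \<Longrightarrow> a \<in> basic_tms P \<Longrightarrow> act (Tm N) \<sigma> a \<in> basic_tms Q"
  by (simp add: basic_tms_def target.Tm.act_closed target.ty_of_natural act_basic_ty)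

lemma var_basic_tms: "P \<in> Ob N \<Longrightarrow> var N P (basic_ty P) \<in> basic_tms (ext N P (basic_ty P))"
  by (simp add: basic_tms_def basic_ty_closed target.var_closed target.ty_of_var
      act_basic_ty[OF target.prj_Hom])

text \<open>Bundled into one predicate because, at an old type, typing the extended image already
  needs the projection to the base of the smaller object. The facts used in that induction step
  therefore take the predicate as a hypothesis.\<close>

definition well_interpreted :: "('o, 't) xobj \<Rightarrow> bool" where
  "well_interpreted c \<longleftrightarrow> img c \<in> Ob N \<and> base_map c \<in> Hom N (img c) (on_ob F (xbase M c)) \<and>
    length (vars c) = xnum c \<and> set (vars c) \<subseteq> basic_tms (img c)"

lemma old_ty_closed:
  "c \<in> xobs M \<Longrightarrow> well_interpreted c \<Longrightarrow> A \<in> sec (Ty M) (xbase M c) \<Longrightarrow> old_ty c A \<in> sec (Ty N) (img c)"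
  unfolding old_ty_def well_interpreted_def
  by (meson on_ty_closed source.xbase_closed target.Ty.act_closed)

lemma base_map_pairing:
  assumes "c \<in> xobs M" "A \<in> sec (Ty M) (xbase M c)" "well_interpreted c"
  defines "P \<equiv> img c" and "B \<equiv> old_ty c A"
  shows "Comp N (base_map c) (prj N P B) \<in> Hom N (ext N P B) (on_ob F (xbase M c))"
    and "on_ty F (xbase M c) A \<in> sec (Ty N) (on_ob F (xbase M c))"
    and "var N P B \<in> sec (Tm N) (ext N P B)"
    and "ty_of N (ext N P B) (var N P B) =
      act (Ty N) (Comp N (base_map c) (prj N P B)) (on_ty F (xbase M c) A)"
proof -
  have P: "P \<in> Ob N" "B \<in> sec (Ty N) P" "base_map c \<in> Hom N P (on_ob F (xbase M c))"
    using assms old_ty_closed by (auto simp: well_interpreted_def)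
  show FA: "on_ty F (xbase M c) A \<in> sec (Ty N) (on_ob F (xbase M c))"
    using assms by (simp add: on_ty_closed source.xbase_closed)
  show "Comp N (base_map c) (prj N P B) \<in> Hom N (ext N P B) (on_ob F (xbase M c))"
    by (rule target.Comp_Hom[OF target.prj_Hom[OF P(1,2)] P(3)])
  show "var N P B \<in> sec (Tm N) (ext N P B)"
    by (rule target.var_closed[OF P(1,2)])
  show "ty_of N (ext N P B) (var N P B) =
      act (Ty N) (Comp N (base_map c) (prj N P B)) (on_ty F (xbase M c) A)"
    using target.Ty.act_Comp[OF target.prj_Hom[OF P(1,2)] P(3) FA] target.ty_of_var[OF P(1,2)]
    by (simp add: B_def old_ty_def)
qed

text \<open>The new projection to the base is a pairing; its components are read off here, and later
  arguments use it only through them.\<close>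

lemma
  assumes "c \<in> xobs M" "A \<in> sec (Ty M) (xbase M c)" "well_interpreted c"
  shows base_map_old_Hom: "base_map (xext M c (OldTy A)) \<in>
      Hom N (img (xext M c (OldTy A))) (on_ob F (ext M (xbase M c) A))"
    and prj_base_map_old: "Comp N (prj N (on_ob F (xbase M c)) (on_ty F (xbase M c) A))
      (base_map (xext M c (OldTy A))) = Comp N (base_map c) (prj N (img c) (old_ty c A))"
    and act_base_map_old_var: "act (Tm N) (base_map (xext M c (OldTy A)))
      (var N (on_ob F (xbase M c)) (on_ty F (xbase M c) A)) = var N (img c) (old_ty c A)"
  using target.pairing_Hom[OF base_map_pairing[OF assms]]
    target.prj_pairing[OF base_map_pairing[OF assms]]
    target.act_pairing_var[OF base_map_pairing[OF assms]] assms
  by (simp_all add: base_map_old img_old on_ob_ext source.xbase_closed)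

lemma well_interpreted: "c \<in> xobs M \<Longrightarrow> well_interpreted c"
proof (induction rule: xobs_induct)
  case (incl \<Gamma>)
  then show ?case
    by (simp add: well_interpreted_def img_incl base_map_incl vars_incl on_ob_closed target.Id_Hom)
next
  case (basic c)
  then have "img c \<in> Ob N" "basic_ty (img c) \<in> sec (Ty N) (img c)"
    by (auto simp: well_interpreted_def basic_ty_closed)
  note p = target.prj_Hom[OF this] target.ext_closed[OF this]
  show ?case
    using basic p var_basic_tms[of "img c"]
    by (auto simp: well_interpreted_def img_basic base_map_basic vars_basic xext_basic
        intro: target.Comp_Hom[OF p(1)] act_basic_tms[OF p(1)])
next
  case (old c A)
  then have "img c \<in> Ob N" "old_ty c A \<in> sec (Ty N) (img c)"
    by (auto simp: well_interpreted_def old_ty_closed)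
  note p = target.prj_Hom[OF this] target.ext_closed[OF this]
  show ?case
    using old p base_map_old_Hom[of c A]
    by (auto simp: well_interpreted_def img_old vars_old xext_old intro: act_basic_tms[OF p(1)])
qed

lemma
  assumes "c \<in> xobs M"
  shows img_closed: "img c \<in> Ob N"
    and base_map_Hom: "base_map c \<in> Hom N (img c) (on_ob F (xbase M c))"
    and length_vars: "length (vars c) = xnum c"
    and vars_basic_tms: "i < xnum c \<Longrightarrow> vars c ! i \<in> basic_tms (img c)"
  using well_interpreted[OF assms] by (auto simp: well_interpreted_def intro: nth_mem)

lemma vars_closed: "c \<in> xobs M \<Longrightarrow> i < xnum c \<Longrightarrow> vars c ! i \<in> sec (Tm N) (img c)"
  using vars_basic_tms by (simp add: basic_tms_def)

lemma
  assumes "c \<in> xobs M"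
  shows vars_basic_nth: "i < xnum c \<Longrightarrow> vars (xext M c BasicTy) ! i =
      act (Tm N) (prj N (img c) (basic_ty (img c))) (vars c ! i)"
    and vars_basic_last: "vars (xext M c BasicTy) ! xnum c = var N (img c) (basic_ty (img c))"
  using assms by (auto simp: vars_basic nth_append length_vars)

lemma vars_old_nth:
  "c \<in> xobs M \<Longrightarrow> A \<in> sec (Ty M) (xbase M c) \<Longrightarrow> i < xnum c \<Longrightarrow>
    vars (xext M c (OldTy A)) ! i = act (Tm N) (prj N (img c) (old_ty c A)) (vars c ! i)"
  by (simp add: vars_old length_vars)

text \<open>
  Together with \<open>img_map_exists\<close>: \<open>img c\<close> is the product of \<open>F (xbase c)\<close> with \<open>xnum c\<close> copies
  of the context extension of the terminal object by \<open>O_ty\<close>.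
\<close>

lemma img_map_eqI:
  assumes "c \<in> xobs M" "\<rho> \<in> Hom N Q (img c)" "\<rho>' \<in> Hom N Q (img c)"
    and "Comp N (base_map c) \<rho> = Comp N (base_map c) \<rho>'"
    and "\<And>i. i < xnum c \<Longrightarrow> act (Tm N) \<rho> (vars c ! i) = act (Tm N) \<rho>' (vars c ! i)"
  shows "\<rho> = \<rho>'"
  using assms
proof (induction arbitrary: \<rho> \<rho>' rule: xobs_induct)
  case (incl \<Gamma>)
  then show ?case
    by (metis base_map_incl img_incl target.Comp_Id_left)
next
  case (basic c)
  note P = img_closed[OF basic.hyps] basic_ty_closed[OF img_closed[OF basic.hyps]]
  let ?p = "prj N (img c) (basic_ty (img c))"
  note p = target.prj_Hom[OF P] and b = base_map_Hom[OF basic.hyps]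
  have \<rho>: "\<rho> \<in> Hom N Q (ext N (img c) (basic_ty (img c)))"
    "\<rho>' \<in> Hom N Q (ext N (img c) (basic_ty (img c)))"
    using basic.prems(1,2) basic.hyps by (simp_all add: img_basic)
  have "Comp N ?p \<rho> = Comp N ?p \<rho>'"
  proof (rule basic.IH)
    show "Comp N (base_map c) (Comp N ?p \<rho>) = Comp N (base_map c) (Comp N ?p \<rho>')"
      using basic.prems(3) basic.hyps
      by (simp add: base_map_basic target.Comp_assoc[OF \<rho>(1) p b] target.Comp_assoc[OF \<rho>(2) p b])
    show "act (Tm N) (Comp N ?p \<rho>) (vars c ! i) = act (Tm N) (Comp N ?p \<rho>') (vars c ! i)"
      if "i < xnum c" for i
      using basic.prems(4)[of i] basic.hyps that
      by (simp add: xext_basic vars_basic_nth target.Tm.act_Comp[OF \<rho>(1) p] target.Tm.act_Comp[OF \<rho>(2) p] vars_closed)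
  qed (use \<rho> p in \<open>auto intro: target.Comp_Hom\<close>)
  moreover have "act (Tm N) \<rho> (var N (img c) (basic_ty (img c))) =
      act (Tm N) \<rho>' (var N (img c) (basic_ty (img c)))"
    using basic.prems(4)[of "xnum c"] basic.hyps by (simp add: xext_basic vars_basic_last)
  ultimately show ?case
    by (rule target.ext_map_eqI[OF \<rho> P])
next
  case (old c A)
  note P = img_closed[OF old.hyps(1)] old_ty_closed[OF old.hyps(1) well_interpreted[OF old.hyps(1)] old.hyps(2)]
  note cA = old.hyps well_interpreted[OF old.hyps(1)]
  let ?p = "prj N (img c) (old_ty c A)" and ?b = "base_map (xext M c (OldTy A))"
  note p = target.prj_Hom[OF P] and b = base_map_Hom[OF old.hyps(1)]
  have F: "on_ob F (xbase M c) \<in> Ob N" "on_ty F (xbase M c) A \<in> sec (Ty N) (on_ob F (xbase M c))"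
    using old.hyps by (simp_all add: on_ob_closed on_ty_closed source.xbase_closed)
  note F' = target.prj_Hom[OF F] target.var_closed[OF F]
  have b': "?b \<in> Hom N (img (xext M c (OldTy A))) (ext N (on_ob F (xbase M c)) (on_ty F (xbase M c) A))"
    using base_map_old_Hom[OF cA] old.hyps by (simp add: on_ob_ext source.xbase_closed)
  have \<rho>: "\<rho> \<in> Hom N Q (ext N (img c) (old_ty c A))" "\<rho>' \<in> Hom N Q (ext N (img c) (old_ty c A))"
    using old.prems(1,2) old.hyps by (simp_all add: img_old)
  \<comment> \<open>This turns agreement of \<open>\<rho>\<close> and \<open>\<rho>'\<close> over
    the extended base into agreement over the base of \<open>c\<close>, as the induction hypothesis
    requires.\<close>
  have "Comp N (base_map c) (Comp N ?p \<tau>) =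
      Comp N (prj N (on_ob F (xbase M c)) (on_ty F (xbase M c) A)) (Comp N ?b \<tau>)"
    if "\<tau> \<in> Hom N Q (ext N (img c) (old_ty c A))" for \<tau>
    using that target.Comp_assoc[OF _ b' F'(1)] target.Comp_assoc[OF _ p b] old.hyps
    by (simp add: img_old prj_base_map_old[OF cA])
  then have "Comp N (base_map c) (Comp N ?p \<rho>) = Comp N (base_map c) (Comp N ?p \<rho>')"
    using old.prems(3) \<rho> by simp
  then have "Comp N ?p \<rho> = Comp N ?p \<rho>'"
  proof (rule old.IH[rotated 2])
    show "act (Tm N) (Comp N ?p \<rho>) (vars c ! i) = act (Tm N) (Comp N ?p \<rho>') (vars c ! i)"
      if "i < xnum c" for i
      using old.prems(4)[of i] old.hyps that
      by (simp add: xext_old vars_old_nth target.Tm.act_Comp[OF \<rho>(1) p] target.Tm.act_Comp[OF \<rho>(2) p] vars_closed)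
  qed (use \<rho> p in \<open>auto intro: target.Comp_Hom\<close>)
  \<comment> \<open>The variable of an old type is not among \<open>vars\<close>; its value is
    recovered from the component over the extended base.\<close>
  moreover have "act (Tm N) \<tau> (var N (img c) (old_ty c A)) = act (Tm N) (Comp N ?b \<tau>)
      (var N (on_ob F (xbase M c)) (on_ty F (xbase M c) A))"
    if "\<tau> \<in> Hom N Q (ext N (img c) (old_ty c A))" for \<tau>
    using that target.Tm.act_Comp[OF _ b' F'(2), of \<tau> Q] old.hyps
    by (simp add: img_old act_base_map_old_var[OF cA])
  then have "act (Tm N) \<rho> (var N (img c) (old_ty c A)) = act (Tm N) \<rho>' (var N (img c) (old_ty c A))"
    using old.prems(3) \<rho> by simp
  ultimately show ?case
    by (rule target.ext_map_eqI[OF \<rho> P])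
qed

text \<open>The map is assembled along the construction of \<open>c\<close>. A basic extension takes
  the last \<open>w i\<close> as its new component, which has the right type because
  \<open>basic_ty\<close> is stable under substitution. An old extension takes the variable part of
  \<open>\<tau>\<close>, while the projected part of \<open>\<tau>\<close> is fed to the induction
  hypothesis.\<close>

lemma img_map_exists:
  assumes "c \<in> xobs M" "\<tau> \<in> Hom N Q (on_ob F (xbase M c))"
    and "\<And>i. i < xnum c \<Longrightarrow> w i \<in> basic_tms Q"
  shows "\<exists>\<rho>. \<rho> \<in> Hom N Q (img c) \<and> Comp N (base_map c) \<rho> = \<tau> \<and>
    (\<forall>i<xnum c. act (Tm N) \<rho> (vars c ! i) = w i)"
  using assms
proof (induction arbitrary: \<tau> w rule: xobs_induct)
  case (incl \<Gamma>)
  then show ?case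
    by (auto simp: base_map_incl img_incl target.Comp_Id_left)
next
  case (basic c)
  note P = img_closed[OF basic.hyps] basic_ty_closed[OF img_closed[OF basic.hyps]]
  let ?p = "prj N (img c) (basic_ty (img c))"
  note p = target.prj_Hom[OF P] and b = base_map_Hom[OF basic.hyps]
  have w: "w i \<in> basic_tms Q" if "i < Suc (xnum c)" for i
    using basic.prems(2)[of i] that basic.hyps by (simp add: xext_basic)
  obtain \<rho> where \<rho>: "\<rho> \<in> Hom N Q (img c)" "Comp N (base_map c) \<rho> = \<tau>"
      "\<forall>i<xnum c. act (Tm N) \<rho> (vars c ! i) = w i"
    using basic.IH[of \<tau> w] basic.prems(1) w basic.hyps by (auto simp: xext_basic)
  have "w (xnum c) \<in> sec (Tm N) Q" "ty_of N Q (w (xnum c)) = act (Ty N) \<rho> (basic_ty (img c))"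
    using w[of "xnum c"] by (simp_all add: basic_tms_def act_basic_ty[OF \<rho>(1)])
  note q = \<rho>(1) P(2) this
  let ?\<rho> = "target.pairing Q (img c) (basic_ty (img c)) \<rho> (w (xnum c))"
  note \<rho>' = target.pairing_Hom[OF q] target.prj_pairing[OF q] target.act_pairing_var[OF q]
  have "act (Tm N) ?\<rho> (vars (xext M c BasicTy) ! i) = w i" if "i < Suc (xnum c)" for i
  proof (cases "i = xnum c")
    case False
    then show ?thesis
      using that basic.hyps \<rho>' \<rho>(3) target.Tm.act_Comp[OF \<rho>'(1) p, of "vars c ! i"]
      by (simp add: vars_basic_nth vars_closed)
  qed (use basic.hyps \<rho>' in \<open>simp add: vars_basic_last\<close>)
  moreover have "Comp N (base_map (xext M c BasicTy)) ?\<rho> = \<tau>"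
    using \<rho>(2) \<rho>' basic.hyps by (simp add: base_map_basic target.Comp_assoc[OF \<rho>'(1) p b])
  ultimately show ?case
    using \<rho>' basic.hyps by (auto simp: xext_basic img_basic)
next
  case (old c A)
  note P = img_closed[OF old.hyps(1)] old_ty_closed[OF old.hyps(1) well_interpreted[OF old.hyps(1)] old.hyps(2)]
  note cA = old.hyps well_interpreted[OF old.hyps(1)]
  let ?p = "prj N (img c) (old_ty c A)" and ?b = "base_map (xext M c (OldTy A))"
  let ?\<Gamma> = "on_ob F (xbase M c)" and ?A = "on_ty F (xbase M c) A"
  note p = target.prj_Hom[OF P] and b = base_map_Hom[OF old.hyps(1)]
  have F: "?\<Gamma> \<in> Ob N" "?A \<in> sec (Ty N) ?\<Gamma>"
    using old.hyps by (simp_all add: on_ob_closed on_ty_closed source.xbase_closed)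
  note F' = target.prj_Hom[OF F] target.var_closed[OF F]
  have b': "?b \<in> Hom N (ext N (img c) (old_ty c A)) (ext N ?\<Gamma> ?A)"
    using base_map_old_Hom[OF cA] old.hyps by (simp add: on_ob_ext source.xbase_closed img_old)
  have \<tau>: "\<tau> \<in> Hom N Q (ext N ?\<Gamma> ?A)"
    using old.prems(1) old.hyps by (simp add: xext_old on_ob_ext source.xbase_closed)
  have w: "w i \<in> basic_tms Q" if "i < xnum c" for i
    using old.prems(2)[of i] that old.hyps by (simp add: xext_old)
  obtain \<rho> where \<rho>: "\<rho> \<in> Hom N Q (img c)" "Comp N (base_map c) \<rho> = Comp N (prj N ?\<Gamma> ?A) \<tau>"
      "\<forall>i<xnum c. act (Tm N) \<rho> (vars c ! i) = w i"
    using old.IH[of "Comp N (prj N ?\<Gamma> ?A) \<tau>" w] w target.Comp_Hom[OF \<tau> F'(1)] by auto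
  have "ty_of N Q (act (Tm N) \<tau> (var N ?\<Gamma> ?A)) = act (Ty N) (Comp N (base_map c) \<rho>) ?A"
    using F \<tau> by (simp add: target.ty_of_natural[OF \<tau> F'(2)] target.ty_of_var \<rho>(2)
        target.Ty.act_Comp[OF \<tau> F'(1)])
  then have "ty_of N Q (act (Tm N) \<tau> (var N ?\<Gamma> ?A)) = act (Ty N) \<rho> (old_ty c A)"
    using F by (simp add: old_ty_def target.Ty.act_Comp[OF \<rho>(1) b])
  note q = \<rho>(1) P(2) target.Tm.act_closed[OF \<tau> F'(2)] this
  let ?\<rho> = "target.pairing Q (img c) (old_ty c A) \<rho> (act (Tm N) \<tau> (var N ?\<Gamma> ?A))"
  note \<rho>' = target.pairing_Hom[OF q] target.prj_pairing[OF q] target.act_pairing_var[OF q]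
  have "act (Tm N) ?\<rho> (vars (xext M c (OldTy A)) ! i) = w i" if "i < xnum c" for i
    using that old.hyps \<rho>' \<rho>(3) target.Tm.act_Comp[OF \<rho>'(1) p, of "vars c ! i"]
    by (simp add: vars_old_nth vars_closed)
  moreover have "Comp N ?b ?\<rho> = \<tau>"
  proof (rule target.ext_map_eqI[OF target.Comp_Hom[OF \<rho>'(1) b'] \<tau> F])
    show "Comp N (prj N ?\<Gamma> ?A) (Comp N ?b ?\<rho>) = Comp N (prj N ?\<Gamma> ?A) \<tau>"
      using target.Comp_assoc[OF \<rho>'(1) b' F'(1)] target.Comp_assoc[OF \<rho>'(1) p b] \<rho>(2) \<rho>'(2)
      by (simp add: prj_base_map_old[OF cA])
    show "act (Tm N) (Comp N ?b ?\<rho>) (var N ?\<Gamma> ?A) = act (Tm N) \<tau> (var N ?\<Gamma> ?A)"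
      using target.Tm.act_Comp[OF \<rho>'(1) b' F'(2)] \<rho>'(3)
      by (simp add: act_base_map_old_var[OF cA])
  qed
  ultimately show ?case
    using \<rho>' old.hyps by (auto simp: xext_old img_old)
qed

section \<open>Values on morphisms, types and terms\<close>

definition ext_ar :: "('o, 'm, 't) xarr \<Rightarrow> 'n" where
  "ext_ar f = (THE \<rho>. \<rho> \<in> Hom N (img (xdom f)) (img (xcod f)) \<and>
    Comp N (base_map (xcod f)) \<rho> = Comp N (on_ar F (xsub f)) (base_map (xdom f)) \<and>
    (\<forall>i<xnum (xcod f). act (Tm N) \<rho> (vars (xcod f) ! i) = vars (xdom f) ! xfun f i))"

text \<open>Maps into \<open>img d\<close> are determined by their base component and the basic
  variables. Functoriality, preservation of projections, compatibility with the inclusion and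
  uniqueness on morphisms are all obtained from this criterion.\<close>

lemma ext_ar_eqI:
  assumes "f \<in> Hom (free_model M) c d" "\<rho> \<in> Hom N (img c) (img d)"
    and "Comp N (base_map d) \<rho> = Comp N (on_ar F (xsub f)) (base_map c)"
    and "\<And>i. i < xnum d \<Longrightarrow> act (Tm N) \<rho> (vars d ! i) = vars c ! xfun f i"
  shows "ext_ar f = \<rho>"
proof -
  note [simp] = Hom_free_modelD(1,2)[OF assms(1)]
  show ?thesis
    unfolding ext_ar_def
  proof (rule the_equality)
    fix \<rho>' assume \<rho>': "\<rho>' \<in> Hom N (img (xdom f)) (img (xcod f)) \<and>
      Comp N (base_map (xcod f)) \<rho>' = Comp N (on_ar F (xsub f)) (base_map (xdom f)) \<and>
      (\<forall>i<xnum (xcod f). act (Tm N) \<rho>' (vars (xcod f) ! i) = vars (xdom f) ! xfun f i)"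
    show "\<rho>' = \<rho>"
      by (rule img_map_eqI[OF Hom_free_modelD(4)[OF assms(1)] _ assms(2)])
        (use \<rho>' assms(3,4) in simp_all)
  qed (use assms(2-4) in simp)
qed

lemma
  assumes f: "f \<in> Hom (free_model M) c d"
  shows ext_ar_Hom: "ext_ar f \<in> Hom N (img c) (img d)"
    and base_map_ext_ar: "Comp N (base_map d) (ext_ar f) = Comp N (on_ar F (xsub f)) (base_map c)"
    and act_ext_ar_vars: "i < xnum d \<Longrightarrow> act (Tm N) (ext_ar f) (vars d ! i) = vars c ! xfun f i"
proof -
  have "c \<in> xobs M" "d \<in> xobs M" "xsub f \<in> Hom M (xbase M c) (xbase M d)"
    "\<And>i. i < xnum d \<Longrightarrow> xfun f i < xnum c"
    using Hom_free_modelD[OF f] by auto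
  then obtain \<rho> where "\<rho> \<in> Hom N (img c) (img d)"
    "Comp N (base_map d) \<rho> = Comp N (on_ar F (xsub f)) (base_map c)"
    "\<forall>i<xnum d. act (Tm N) \<rho> (vars d ! i) = vars c ! xfun f i"
    using img_map_exists[of d "Comp N (on_ar F (xsub f)) (base_map c)" "img c" "\<lambda>i. vars c ! xfun f i"]
    by (auto simp: vars_basic_tms intro: target.Comp_Hom base_map_Hom on_ar_Hom)
  moreover from this have "ext_ar f = \<rho>"
    by (intro ext_ar_eqI[OF f]) auto
  ultimately show "ext_ar f \<in> Hom N (img c) (img d)"
    "Comp N (base_map d) (ext_ar f) = Comp N (on_ar F (xsub f)) (base_map c)"
    "i < xnum d \<Longrightarrow> act (Tm N) (ext_ar f) (vars d ! i) = vars c ! xfun f i"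
    by auto
qed

definition ext_ty :: "('o, 't) xobj \<Rightarrow> 't xty \<Rightarrow> 'u" where
  "ext_ty c B = (case B of BasicTy \<Rightarrow> basic_ty (img c) | OldTy A \<Rightarrow> old_ty c A)"

definition ext_tm :: "('o, 't) xobj \<Rightarrow> 'e xtm \<Rightarrow> 'f" where
  "ext_tm c a = (case a of BasicTm i \<Rightarrow> vars c ! i
    | OldTm a \<Rightarrow> act (Tm N) (base_map c) (on_tm F (xbase M c) a))"

lemma ext_ty_simps [simp]: "ext_ty c BasicTy = basic_ty (img c)" "ext_ty c (OldTy A) = old_ty c A"
  by (simp_all add: ext_ty_def)

lemma ext_tm_simps [simp]: "ext_tm c (BasicTm i) = vars c ! i"
  "ext_tm c (OldTm a) = act (Tm N) (base_map c) (on_tm F (xbase M c) a)"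
  by (simp_all add: ext_tm_def)

lemma ext_ty_closed:
  "c \<in> xobs M \<Longrightarrow> B \<in> sec (Ty (free_model M)) c \<Longrightarrow> ext_ty c B \<in> sec (Ty N) (img c)"
  by (auto simp: basic_ty_closed img_closed old_ty_closed well_interpreted)

lemma ext_tm_closed:
  "c \<in> xobs M \<Longrightarrow> a \<in> sec (Tm (free_model M)) c \<Longrightarrow> ext_tm c a \<in> sec (Tm N) (img c)"
  by (auto simp: vars_closed intro!: target.Tm.act_closed[OF base_map_Hom] on_tm_closed
      source.xbase_closed)

text \<open>For an old type both sides are pullbacks of its value under \<open>F\<close>, along the
  two composites of the commuting square in \<open>base_map_ext_ar\<close>; for the basic type this
  is stability of \<open>basic_ty\<close>.\<close>

lemma ext_ty_natural:
  assumes f: "f \<in> Hom (free_model M) c d" and B: "B \<in> sec (Ty (free_model M)) d"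
  shows "ext_ty c (xty_act M f B) = act (Ty N) (ext_ar f) (ext_ty d B)"
proof (cases B)
  case BasicTy
  then show ?thesis
    by (simp add: act_basic_ty[OF ext_ar_Hom[OF f]])
next
  case (OldTy A)
  have cd: "c \<in> xobs M" "d \<in> xobs M" "xsub f \<in> Hom M (xbase M c) (xbase M d)"
    using Hom_free_modelD[OF f] by auto
  have A: "A \<in> sec (Ty M) (xbase M d)" using B OldTy by auto
  then have FA: "on_ty F (xbase M d) A \<in> sec (Ty N) (on_ob F (xbase M d))"
    using cd by (simp add: on_ty_closed source.xbase_closed)
  show ?thesis
    using target.Ty.act_Comp[OF ext_ar_Hom[OF f] base_map_Hom[OF cd(2)] FA]
      target.Ty.act_Comp[OF base_map_Hom[OF cd(1)] on_ar_Hom[OF cd(3)] FA]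
    by (simp add: OldTy old_ty_def on_ty_natural[OF cd(3) A] base_map_ext_ar[OF f])
qed

lemma ext_tm_natural:
  assumes f: "f \<in> Hom (free_model M) c d" and a: "a \<in> sec (Tm (free_model M)) d"
  shows "ext_tm c (xtm_act M f a) = act (Tm N) (ext_ar f) (ext_tm d a)"
proof (cases a)
  case (BasicTm i)
  then show ?thesis
    using a by (auto simp: act_ext_ar_vars[OF f])
next
  case (OldTm a')
  have cd: "c \<in> xobs M" "d \<in> xobs M" "xsub f \<in> Hom M (xbase M c) (xbase M d)"
    using Hom_free_modelD[OF f] by auto
  have a': "a' \<in> sec (Tm M) (xbase M d)" using a OldTm by auto
  then have Fa: "on_tm F (xbase M d) a' \<in> sec (Tm N) (on_ob F (xbase M d))"
    using cd by (simp add: on_tm_closed source.xbase_closed)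
  show ?thesis
    using target.Tm.act_Comp[OF ext_ar_Hom[OF f] base_map_Hom[OF cd(2)] Fa]
      target.Tm.act_Comp[OF base_map_Hom[OF cd(1)] on_ar_Hom[OF cd(3)] Fa]
    by (simp add: OldTm on_tm_natural[OF cd(3) a'] base_map_ext_ar[OF f])
qed

lemma ty_of_ext_tm:
  assumes c: "c \<in> xobs M" and a: "a \<in> sec (Tm (free_model M)) c"
  shows "ty_of N (img c) (ext_tm c a) = ext_ty c (xty_of M c a)"
proof (cases a)
  case (BasicTm i)
  then show ?thesis
    using c a vars_basic_tms[OF c, of i] by (auto simp: basic_tms_def)
next
  case (OldTm a')
  then have "a' \<in> sec (Tm M) (xbase M c)" using a by auto
  then show ?thesis
    using c target.ty_of_natural[OF base_map_Hom[OF c], of "on_tm F (xbase M c) a'"]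
    by (simp add: OldTm old_ty_def on_tm_closed source.xbase_closed ty_of_on_tm)
qed

lemma img_ext:
  "c \<in> xobs M \<Longrightarrow> B \<in> sec (Ty (free_model M)) c \<Longrightarrow>
    img (xext M c B) = ext N (img c) (ext_ty c B)"
  by (auto simp: img_basic img_old)

text \<open>The projection keeps every index, which matches the weakening of \<open>vars\<close>.
  Over the base, the basic case is how \<open>base_map\<close> was defined, and the old case is the
  projection equation of the pairing.\<close>

lemma ext_ar_prj:
  assumes c: "c \<in> xobs M" and B: "B \<in> sec (Ty (free_model M)) c"
  shows "ext_ar (xprj M c B) = prj N (img c) (ext_ty c B)"
proof (rule ext_ar_eqI)
  interpret X: natural_model "free_model M" by (rule source.natural_model_free_model)
  show "xprj M c B \<in> Hom (free_model M) (xext M c B) c"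
    using X.prj_Hom[of c B] c B by simp
  show "prj N (img c) (ext_ty c B) \<in> Hom N (img (xext M c B)) (img c)"
    using c B ext_ty_closed[OF c B] by (auto simp: img_ext target.prj_Hom img_closed)
  show "Comp N (base_map c) (prj N (img c) (ext_ty c B)) =
      Comp N (on_ar F (xsub (xprj M c B))) (base_map (xext M c B))"
  proof (cases B)
    case BasicTy
    have "Comp N (base_map c) (prj N (img c) (basic_ty (img c))) \<in>
        Hom N (ext N (img c) (basic_ty (img c))) (on_ob F (xbase M c))"
      by (rule target.Comp_Hom[OF target.prj_Hom base_map_Hom[OF c]])
        (simp_all add: c img_closed basic_ty_closed)
    with c show ?thesis
      by (simp add: BasicTy base_map_basic on_ar_Id source.xbase_closed target.Comp_Id_left)
  next
    case (OldTy A)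
    then have A: "A \<in> sec (Ty M) (xbase M c)" using B by auto
    with c show ?thesis
      by (simp add: OldTy on_ar_prj source.xbase_closed prj_base_map_old[OF c A well_interpreted[OF c]])
  qed
  show "act (Tm N) (prj N (img c) (ext_ty c B)) (vars c ! i) =
      vars (xext M c B) ! xfun (xprj M c B) i" if "i < xnum c" for i
    using c B that by (auto simp: vars_basic_nth vars_old_nth)
qed

text \<open>Indices start at 0, so the new index \<open>xnum c\<close> points to the last entry of
  \<open>vars\<close>. For an old type, the variable over the base pulls back along the pairing to
  the variable over the image.\<close>

lemma ext_tm_var:
  assumes c: "c \<in> xobs M" and B: "B \<in> sec (Ty (free_model M)) c"
  shows "ext_tm (xext M c B) (xvar M c B) = var N (img c) (ext_ty c B)"
proof (cases B)
  case BasicTy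
  then show ?thesis
    using c by (simp add: vars_basic_last)
next
  case (OldTy A)
  then have A: "A \<in> sec (Ty M) (xbase M c)" using B by auto
  with c show ?thesis
    by (simp add: OldTy xext_old on_tm_var source.xbase_closed act_base_map_old_var[OF c A well_interpreted[OF c]])
qed

section \<open>The extension as a morphism of natural models\<close>

definition extension ::
    "(('o, 't) xobj, ('o, 'm, 't) xarr, 't xty, 'e xtm, 'p, 'n, 'u, 'f) natmod_map" where
  "extension = \<lparr>
    on_ob = restrict img (xobs M),
    on_ar = restrict ext_ar (Ar (free_model M)),
    on_ty = (\<lambda>c\<in>xobs M. restrict (ext_ty c) (sec (Ty (free_model M)) c)),
    on_tm = (\<lambda>c\<in>xobs M. restrict (ext_tm c) (sec (Tm (free_model M)) c))\<rparr>"

lemma extension_simps: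
  "c \<in> xobs M \<Longrightarrow> on_ob extension c = img c"
  "f \<in> Hom (free_model M) c d \<Longrightarrow> on_ar extension f = ext_ar f"
  "c \<in> xobs M \<Longrightarrow> B \<in> sec (Ty (free_model M)) c \<Longrightarrow> on_ty extension c B = ext_ty c B"
  "c \<in> xobs M \<Longrightarrow> a \<in> sec (Tm (free_model M)) c \<Longrightarrow> on_tm extension c a = ext_tm c a"
  by (simp_all only: extension_def restrict_apply natmod_map.simps if_True)
    (simp add: Hom_def)

lemma morphism_extension: "natural_model_morphism (free_model M) N extension"
proof -
  interpret X: natural_model "free_model M" by (rule source.natural_model_free_model)
  have ar: "ext_ar f \<in> Ar N" if "f \<in> Ar (free_model M)" for f
    by (rule target.Hom_Ar[OF ext_ar_Hom[of f "xdom f" "xcod f"]]) (simp add: Hom_def that)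
  show ?thesis
  proof (intro natural_model_morphism.intro natural_model_morphism_axioms.intro)
    show "on_ob extension \<in> Ob (free_model M) \<rightarrow>\<^sub>E Ob N"
      by (auto simp: extension_def img_closed)
    show "on_ar extension \<in> Ar (free_model M) \<rightarrow>\<^sub>E Ar N"
      by (auto simp: extension_def ar)
    show "on_ty extension \<in> (\<Pi>\<^sub>E c\<in>Ob (free_model M).
        sec (Ty (free_model M)) c \<rightarrow>\<^sub>E sec (Ty N) (on_ob extension c))"
      unfolding extension_def free_model_simps(1) natmod_map.simps restrict_PiE_iff
      by (simp add: ext_ty_closed restrict_PiE_iff del: free_model_simps(7))
    show "on_tm extension \<in> (\<Pi>\<^sub>E c\<in>Ob (free_model M).
        sec (Tm (free_model M)) c \<rightarrow>\<^sub>E sec (Tm N) (on_ob extension c))"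
      unfolding extension_def free_model_simps(1) natmod_map.simps restrict_PiE_iff
      by (simp add: ext_tm_closed restrict_PiE_iff del: free_model_simps(9))
    show "on_ob extension (emp (free_model M)) = emp N"
      using source.emp_closed
      by (simp add: extension_simps source.xobs_incl img_incl on_ob_emp)
  next
    fix f c d assume f: "f \<in> Hom (free_model M) c d"
    then have cd: "c \<in> xobs M" "d \<in> xobs M"
      by (rule Hom_free_modelD)+
    show "on_ar extension f \<in> Hom N (on_ob extension c) (on_ob extension d)"
      by (simp add: extension_simps(1)[OF cd(1)] extension_simps(1)[OF cd(2)]
          extension_simps(2)[OF f] ext_ar_Hom[OF f])
    show "on_ty extension c (act (Ty (free_model M)) f B) =
        act (Ty N) (on_ar extension f) (on_ty extension d B)"
      if "B \<in> sec (Ty (free_model M)) d" for B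
      using X.Ty.act_closed[OF f that]
      by (simp add: extension_simps(2)[OF f] extension_simps(3)[OF cd(2) that]
          extension_simps(3)[OF cd(1)] ext_ty_natural[OF f that] del: free_model_simps(7))
    show "on_tm extension c (act (Tm (free_model M)) f a) =
        act (Tm N) (on_ar extension f) (on_tm extension d a)"
      if "a \<in> sec (Tm (free_model M)) d" for a
      using X.Tm.act_closed[OF f that]
      by (simp add: extension_simps(2)[OF f] extension_simps(4)[OF cd(2) that]
          extension_simps(4)[OF cd(1)] ext_tm_natural[OF f that] del: free_model_simps(9))
    fix g e assume g: "g \<in> Hom (free_model M) e c"
    then have e: "e \<in> xobs M" by (rule Hom_free_modelD)
    have "ext_ar (Comp (free_model M) f g) = Comp N (ext_ar f) (ext_ar g)"
    proof (rule ext_ar_eqI[OF X.Comp_Hom[OF g f] target.Comp_Hom[OF ext_ar_Hom[OF g] ext_ar_Hom[OF f]]])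
      have s: "xsub g \<in> Hom M (xbase M e) (xbase M c)" "xsub f \<in> Hom M (xbase M c) (xbase M d)"
        by (rule Hom_free_modelD[OF g] Hom_free_modelD[OF f])+
      \<comment> \<open>The squares for \<open>g\<close> and \<open>f\<close> over the base are
        pasted; associativity slides the projections to the base past the maps.\<close>
      note assoc = target.Comp_assoc[OF ext_ar_Hom[OF g] ext_ar_Hom[OF f] base_map_Hom[OF cd(2)]]
        target.Comp_assoc[OF ext_ar_Hom[OF g] base_map_Hom[OF cd(1)] on_ar_Hom[OF s(2)]]
        target.Comp_assoc[OF base_map_Hom[OF e] on_ar_Hom[OF s(1)] on_ar_Hom[OF s(2)]]
      then show "Comp N (base_map d) (Comp N (ext_ar f) (ext_ar g)) =
          Comp N (on_ar F (xsub (Comp (free_model M) f g))) (base_map e)"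
        by (simp add: base_map_ext_ar[OF f] base_map_ext_ar[OF g] on_ar_Comp[OF s])
      show "act (Tm N) (Comp N (ext_ar f) (ext_ar g)) (vars d ! i) =
          vars e ! xfun (Comp (free_model M) f g) i" if "i < xnum d" for i
        using that PiE_mem[OF Hom_free_modelD(6)[OF f], of i] Hom_free_modelD(2)[OF f]
        by (simp add: target.Tm.act_Comp[OF ext_ar_Hom[OF g] ext_ar_Hom[OF f] vars_closed[OF cd(2) that]]
            act_ext_ar_vars[OF g] act_ext_ar_vars[OF f that] compose_def)
    qed
    then show "on_ar extension (Comp (free_model M) f g) =
        Comp N (on_ar extension f) (on_ar extension g)"
      using extension_simps(2) f g X.Comp_Hom[OF g f] by metis
  next
    fix c assume "c \<in> Ob (free_model M)"
    then have c: "c \<in> xobs M" by simp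
    then have "Id (free_model M) c \<in> Hom (free_model M) c c"
      using X.Id_Hom[of c] by simp
    moreover from this have "ext_ar (Id (free_model M) c) = Id N (img c)"
      using c by (intro ext_ar_eqI[where c = c and d = c])
        (simp_all add: img_closed target.Id_Hom on_ar_Id source.xbase_closed
          target.Comp_Id_left[OF base_map_Hom] target.Comp_Id_right[OF base_map_Hom]
          target.Tm.act_Id vars_closed)
    ultimately show "on_ar extension (Id (free_model M) c) = Id N (on_ob extension c)"
      using c extension_simps(1,2) by metis
    show "ty_of N (on_ob extension c) (on_tm extension c a) =
        on_ty extension c (ty_of (free_model M) c a)" if "a \<in> sec (Tm (free_model M)) c" for a
      using X.ty_of_closed[of c a] c that
      by (simp add: extension_simps ty_of_ext_tm del: free_model_simps(7,9))
    fix B assume B: "B \<in> sec (Ty (free_model M)) c"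
    show "on_ob extension (ext (free_model M) c B) = ext N (on_ob extension c) (on_ty extension c B)"
      using c B X.ext_closed[of c B] by (simp add: extension_simps img_ext del: free_model_simps(7))
    have "prj (free_model M) c B \<in> Hom (free_model M) (ext (free_model M) c B) c"
      using X.prj_Hom[of c B] c B by simp
    from extension_simps(2)[OF this]
    show "on_ar extension (prj (free_model M) c B) = prj N (on_ob extension c) (on_ty extension c B)"
      using c B by (simp add: extension_simps ext_ar_prj del: free_model_simps(7))
    show "on_tm extension (ext (free_model M) c B) (var (free_model M) c B) =
        var N (on_ob extension c) (on_ty extension c B)"
      using c B X.ext_closed[of c B] X.var_closed[of c B]
      by (simp add: extension_simps ext_tm_var del: free_model_simps(7,9))
  qed (fact source.natural_model_free_model target.natural_model_axioms)+
qed

end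

section \<open>Uniqueness\<close>

context natural_model
begin

definition incl_ar :: "'m \<Rightarrow> ('o, 'm, 't) xarr" where
  "incl_ar \<sigma> = XArr (xclass M (Dom M \<sigma>, 0, [])) \<sigma> (\<lambda>i\<in>{..<0}. i) (xclass M (Cod M \<sigma>, 0, []))"

lemma incl_ar_Hom:
  assumes "\<sigma> \<in> Hom M \<Delta> \<Gamma>"
  shows "incl_ar \<sigma> \<in> Hom (free_model M) (xclass M (\<Delta>, 0, [])) (xclass M (\<Gamma>, 0, []))"
proof -
  have "Dom M \<sigma> = \<Delta>" "Cod M \<sigma> = \<Gamma>" using assms by (simp_all add: Hom_def)
  with assms show ?thesis
    by (simp add: incl_ar_def XArr_Hom_iff xobs_incl Hom_dom[OF assms] Hom_cod[OF assms]
        restrict_def)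
qed

text \<open>The morphism that forgets all indices; its second component is the empty function. Any
  solution is forced to send it to \<open>base_map c\<close>.\<close>

definition base_ar :: "('o, 't) xobj \<Rightarrow> ('o, 'm, 't) xarr" where
  "base_ar c = XArr c (Id M (xbase M c)) (\<lambda>i\<in>{..<0}. i) (xclass M (xbase M c, 0, []))"

lemma base_ar_Hom:
  "c \<in> xobs M \<Longrightarrow> base_ar c \<in> Hom (free_model M) c (xclass M (xbase M c, 0, []))"
  by (simp add: base_ar_def XArr_Hom_iff xobs_incl xbase_closed Id_Hom restrict_def)

lemma base_ar_incl: "base_ar (xclass M (\<Gamma>, 0, [])) = Id (free_model M) (xclass M (\<Gamma>, 0, []))"
  by (simp add: base_ar_def)

text \<open>Into an object without indices only the base component matters, and both composites have
  base component \<open>xsub f\<close>. Applying a solution to this square brings in the values of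
  \<open>F\<close> on morphisms.\<close>

lemma incl_ar_base_ar:
  assumes f: "f \<in> Hom (free_model M) c d"
  shows "Comp (free_model M) (base_ar d) f = Comp (free_model M) (incl_ar (xsub f)) (base_ar c)"
proof -
  note D = Hom_free_modelD[OF f]
  have "Dom M (xsub f) = xbase M c" "Cod M (xsub f) = xbase M d"
    using D(5) by (simp_all add: Hom_def)
  then show ?thesis
    using D by (simp add: base_ar_def incl_ar_def Comp_Id_left[OF D(5)] Comp_Id_right[OF D(5)]
        compose_def restrict_def)
qed

text \<open>Such a factorisation works because the basic type leaves the base unchanged. An old type
  changes it, and there the value of a solution is pinned down by the pullback property in
  \<open>N\<close> instead.\<close>

lemma base_ar_basic:
  assumes "c \<in> xobs M"
  shows "base_ar (xext M c BasicTy) = Comp (free_model M) (base_ar c) (xprj M c BasicTy)"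
  using assms Comp_Id_left[OF Id_Hom[OF xbase_closed[OF assms]]]
  by (simp add: base_ar_def xext_basic compose_def restrict_def)

end

text \<open>
  In the free model every old type and term is pulled back along \<open>base_ar c\<close> from the image of
  the inclusion, so a morphism out of it is determined by its values on the maps \<open>base_ar c\<close>, on
  the basic variables, and on the image of the inclusion.
\<close>

locale free_extension_solution = free_extension M N F O_ty +
    G: natural_model_morphism "free_model M" N G
  for M :: "('o, 'm, 't, 'e) natmod" and N :: "('p, 'n, 'u, 'f) natmod"
    and F :: "('o, 'm, 't, 'e, 'p, 'n, 'u, 'f) natmod_map" and O_ty :: 'u
    and G :: "(('o, 't) xobj, ('o, 'm, 't) xarr, 't xty, 'e xtm, 'p, 'n, 'u, 'f) natmod_map" +
  assumes G_inclusion: "natmod_comp M G (free_inclusion M) = F"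
    and G_basic: "on_ty G (emp (free_model M)) BasicTy = O_ty"
begin

abbreviation incl :: "'o \<Rightarrow> ('o, 't) xobj" where
  "incl \<Gamma> \<equiv> xclass M (\<Gamma>, 0, [])"

lemma G_incl_ob: "\<Gamma> \<in> Ob M \<Longrightarrow> on_ob G (incl \<Gamma>) = on_ob F \<Gamma>"
  by (subst G_inclusion[symmetric]) (simp add: natmod_comp_def free_inclusion_def)

lemma G_incl_ar: "\<sigma> \<in> Hom M \<Delta> \<Gamma> \<Longrightarrow> on_ar G (source.incl_ar \<sigma>) = on_ar F \<sigma>"
  by (subst G_inclusion[symmetric])
    (simp add: natmod_comp_def free_inclusion_def source.incl_ar_def source.Hom_Ar)

lemma G_incl_ty:
  "\<Gamma> \<in> Ob M \<Longrightarrow> A \<in> sec (Ty M) \<Gamma> \<Longrightarrow> on_ty G (incl \<Gamma>) (OldTy A) = on_ty F \<Gamma> A"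
  by (subst G_inclusion[symmetric]) (simp add: natmod_comp_def free_inclusion_def)

lemma G_incl_tm:
  "\<Gamma> \<in> Ob M \<Longrightarrow> a \<in> sec (Tm M) \<Gamma> \<Longrightarrow> on_tm G (incl \<Gamma>) (OldTm a) = on_tm F \<Gamma> a"
  by (subst G_inclusion[symmetric]) (simp add: natmod_comp_def free_inclusion_def)

lemma G_basic_ty:
  assumes "c \<in> xobs M"
  shows "on_ty G c BasicTy = basic_ty (on_ob G c)"
proof -
  obtain f where f: "f \<in> Hom (free_model M) c (emp (free_model M))"
    using G.source.bang_Hom[of c] assms by auto
  have "on_ar G f = target.bang (on_ob G c)"
    using G.on_ar_Hom[OF f] by (simp only: G.on_ob_emp target.bang_unique)
  with G.on_ty_natural[OF f, of BasicTy] G_basic show ?thesis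
    by (simp add: basic_ty_def)
qed

lemma G_old_ty:
  assumes "c \<in> xobs M" "A \<in> sec (Ty M) (xbase M c)"
  shows "on_ty G c (OldTy A) = act (Ty N) (on_ar G (source.base_ar c)) (on_ty F (xbase M c) A)"
  using G.on_ty_natural[OF source.base_ar_Hom[OF assms(1)], of "OldTy A"] assms
  by (simp add: G_incl_ty source.xbase_closed source.base_ar_def source.Ty.act_Id)

lemma G_old_tm:
  assumes "c \<in> xobs M" "a \<in> sec (Tm M) (xbase M c)"
  shows "on_tm G c (OldTm a) = act (Tm N) (on_ar G (source.base_ar c)) (on_tm F (xbase M c) a)"
  using G.on_tm_natural[OF source.base_ar_Hom[OF assms(1)], of "OldTm a"] assms
  by (simp add: G_incl_tm source.xbase_closed source.base_ar_def source.Tm.act_Id)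

lemma G_base_ar:
  assumes f: "f \<in> Hom (free_model M) c d"
  shows "Comp N (on_ar G (source.base_ar d)) (on_ar G f) =
    Comp N (on_ar F (xsub f)) (on_ar G (source.base_ar c))"
proof -
  note D = Hom_free_modelD[OF f]
  show ?thesis
    using G.on_ar_Comp[OF f source.base_ar_Hom[OF D(4)]] source.incl_ar_base_ar[OF f]
      G.on_ar_Comp[OF source.base_ar_Hom[OF D(3)] source.incl_ar_Hom[OF D(5)]]
      G_incl_ar[OF D(5)] by metis
qed

lemma G_vars_prj:
  assumes c: "c \<in> xobs M" and B: "B \<in> sec (Ty (free_model M)) c" and i: "i < xnum c"
  shows "on_tm G (xext M c B) (BasicTm i) =
    act (Tm N) (prj N (on_ob G c) (on_ty G c B)) (on_tm G c (BasicTm i))"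
proof -
  have "xprj M c B \<in> Hom (free_model M) (xext M c B) c"
    using G.source.prj_Hom[of c B] c B by simp
  from G.on_tm_natural[OF this, of "BasicTm i"] show ?thesis
    using i G.on_ar_prj[of c B] c B by (cases B) auto
qed

text \<open>The claims need each other: the value at an old type is a pullback along the image of
  \<open>base_ar c\<close>, the image of the extension depends on that value, and the next
  projection to the base is compared with \<open>base_map\<close> in a hom set out of that
  image.\<close>

lemma G_determined:
  assumes "c \<in> xobs M"
  shows "on_ob G c = img c \<and> on_ar G (source.base_ar c) = base_map c \<and>
    (\<forall>i<xnum c. on_tm G c (BasicTm i) = vars c ! i)"
  using assms
proof (induction rule: xobs_induct)
  case (incl \<Gamma>)
  then have "on_ar G (Id (free_model M) (incl \<Gamma>)) = Id N (on_ob G (incl \<Gamma>))"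
    by (intro G.on_ar_Id) (simp add: source.xobs_incl)
  with incl show ?case
    by (simp add: source.base_ar_incl G_incl_ob img_incl base_map_incl
        del: free_model_simps(4))
next
  case (basic c)
  note c = basic.hyps
  have B: "BasicTy \<in> sec (Ty (free_model M)) c" by simp
  have ty: "on_ty G c BasicTy = basic_ty (img c)"
    using basic.IH G_basic_ty[OF c] by simp
  have prj: "xprj M c BasicTy \<in> Hom (free_model M) (xext M c BasicTy) c"
    using G.source.prj_Hom[OF _ B] c by simp
  have ar: "on_ar G (source.base_ar (xext M c BasicTy)) = base_map (xext M c BasicTy)"
    using basic.IH ty G.on_ar_prj[OF _ B] c G.on_ar_Comp[OF prj source.base_ar_Hom[OF c]]
    by (simp add: source.base_ar_basic base_map_basic del: free_model_simps(5) xprj.simps)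
  have "on_tm G (xext M c BasicTy) (BasicTm i) = vars (xext M c BasicTy) ! i"
    if "i < Suc (xnum c)" for i
  proof (cases "i = xnum c")
    case True
    then show ?thesis
      using G.on_tm_var[OF _ B] c basic.IH ty by (simp add: vars_basic_last)
  next
    case False
    then show ?thesis
      using G_vars_prj[OF c B, of i] that basic.IH ty c by (simp add: vars_basic_nth)
  qed
  with ar show ?case
    using G.on_ob_ext[OF _ B] c basic.IH ty by (simp add: xext_basic img_basic)
next
  case (old c A)
  note c = old.hyps(1) and A = old.hyps(2)
  note cA = c A well_interpreted[OF c]
  let ?c = "xext M c (OldTy A)" and ?\<Gamma> = "on_ob F (xbase M c)" and ?A = "on_ty F (xbase M c) A"
  have B: "OldTy A \<in> sec (Ty (free_model M)) c" using A by simp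
  have ty: "on_ty G c (OldTy A) = old_ty c A"
    using old.IH G_old_ty[OF c A] by (simp add: old_ty_def)
  have prj: "xprj M c (OldTy A) \<in> Hom (free_model M) ?c c"
    using G.source.prj_Hom[OF _ B] c by simp
  have ob: "on_ob G ?c = img ?c"
    using G.on_ob_ext[OF _ B] c old.IH ty by (simp add: img_old[OF c A])
  have F: "?\<Gamma> \<in> Ob N" "?A \<in> sec (Ty N) ?\<Gamma>"
    using c A by (simp_all add: on_ob_closed on_ty_closed source.xbase_closed)
  have c': "?c \<in> xobs M" "xbase M ?c = ext M (xbase M c) A" "ext M (xbase M c) A \<in> Ob M"
    using c A by (simp_all add: xext_old source.ext_closed source.xbase_closed)
  have "on_ar G (source.base_ar ?c) = base_map ?c"
  proof (rule target.ext_map_eqI[OF _ _ F])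
    show "on_ar G (source.base_ar ?c) \<in> Hom N (img ?c) (ext N ?\<Gamma> ?A)"
      using G.on_ar_Hom[OF source.base_ar_Hom[OF c'(1)]] ob c' c A
      by (simp add: G_incl_ob on_ob_ext source.xbase_closed)
    show "base_map ?c \<in> Hom N (img ?c) (ext N ?\<Gamma> ?A)"
      using base_map_old_Hom[OF cA] c A by (simp add: on_ob_ext source.xbase_closed)
    show "Comp N (prj N ?\<Gamma> ?A) (on_ar G (source.base_ar ?c)) =
        Comp N (prj N ?\<Gamma> ?A) (base_map ?c)"
      using G_base_ar[OF prj] prj_base_map_old[OF cA] old.IH ty c A G.on_ar_prj[OF _ B]
      by (simp add: on_ar_prj source.xbase_closed)
    \<comment> \<open>The variable of an old extension is an old term, so its value under
      \<open>G\<close> is a pullback along the image of \<open>base_ar ?c\<close>; since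
      \<open>G\<close> preserves variables, the same value is the chosen variable in
      \<open>N\<close>.\<close>
    show "act (Tm N) (on_ar G (source.base_ar ?c)) (var N ?\<Gamma> ?A) =
        act (Tm N) (base_map ?c) (var N ?\<Gamma> ?A)"
      using G_old_tm[OF c'(1), of "var M (xbase M c) A"] act_base_map_old_var[OF cA] c A c'
        old.IH ty G.on_tm_var[OF _ B]
      by (simp add: on_tm_var source.xbase_closed source.var_closed)
  qed
  moreover have "on_tm G ?c (BasicTm i) = vars ?c ! i" if "i < xnum c" for i
    using G_vars_prj[OF c B that] that old.IH ty by (simp add: vars_old_nth[OF c A])
  ultimately show ?case
    using ob c A by (simp add: xext_old)
qed

lemma G_eq_extension: "G = extension"
proof -
  have ob: "on_ob G = on_ob extension"
    using G.on_ob_PiE G_determined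
    by (intro extensionalityI[of _ "xobs M"]) (auto simp: extension_def PiE_iff)
  \<comment> \<open>The square over the base and naturality of \<open>G\<close> on basic variables
    supply exactly the data that characterise \<open>ext_ar f\<close>.\<close>
  have "on_ar G f = ext_ar f" if f: "f \<in> Hom (free_model M) c d" for f c d
  proof (rule ext_ar_eqI[OF f, symmetric])
    note cd = Hom_free_modelD[OF f]
    show "on_ar G f \<in> Hom N (img c) (img d)"
      using G.on_ar_Hom[OF f] G_determined cd by simp
    show "Comp N (base_map d) (on_ar G f) = Comp N (on_ar F (xsub f)) (base_map c)"
      using G_base_ar[OF f] G_determined cd by simp
    show "act (Tm N) (on_ar G f) (vars d ! i) = vars c ! xfun f i" if "i < xnum d" for i
      using G.on_tm_natural[OF f, of "BasicTm i"] G_determined[OF cd(3)] G_determined[OF cd(4)]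
        PiE_mem[OF cd(6), of i] that by simp
  qed
  then have "on_ar G f = on_ar extension f" if "f \<in> Ar (free_model M)" for f
    using that by (simp add: extension_def Hom_def)
  then have ar: "on_ar G = on_ar extension"
    using G.on_ar_PiE
    by (intro extensionalityI[of _ "Ar (free_model M)"]) (auto simp: extension_def PiE_iff)
  have ty: "on_ty G = on_ty extension"
  proof (rule extensionalityI[of _ "xobs M"])
    fix c assume c: "c \<in> xobs M"
    show "on_ty G c = on_ty extension c"
    proof (rule extensionalityI[of _ "sec (Ty (free_model M)) c"])
      show "on_ty G c \<in> extensional (sec (Ty (free_model M)) c)"
        using G.on_ty_PiE c by (simp add: PiE_iff del: free_model_simps(7))
      show "on_ty G c B = on_ty extension c B" if "B \<in> sec (Ty (free_model M)) c" for B
        using that c G_determined[OF c]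
        by (auto simp: extension_simps G_basic_ty G_old_ty old_ty_def)
    qed (use c in \<open>simp add: extension_def del: free_model_simps(7)\<close>)
  qed (use G.on_ty_PiE in \<open>simp_all add: extension_def PiE_iff\<close>)
  have tm: "on_tm G = on_tm extension"
  proof (rule extensionalityI[of _ "xobs M"])
    fix c assume c: "c \<in> xobs M"
    show "on_tm G c = on_tm extension c"
    proof (rule extensionalityI[of _ "sec (Tm (free_model M)) c"])
      show "on_tm G c \<in> extensional (sec (Tm (free_model M)) c)"
        using G.on_tm_PiE c by (simp add: PiE_iff del: free_model_simps(9))
      show "on_tm G c a = on_tm extension c a" if "a \<in> sec (Tm (free_model M)) c" for a
        using that c G_determined[OF c]
        by (auto simp: extension_simps G_old_tm)
    qed (use c in \<open>simp add: extension_def del: free_model_simps(9)\<close>)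
  qed (use G.on_tm_PiE in \<open>simp_all add: extension_def PiE_iff\<close>)
  from ob ar ty tm show ?thesis
    by (simp add: natmod_map.equality)
qed

end

section \<open>The two equations required of the extension\<close>

context free_extension
begin

lemma extension_inclusion: "natmod_comp M extension (free_inclusion M) = F"
proof (rule natmod_map.equality)
  let ?F = "natmod_comp M extension (free_inclusion M)"
  show "on_ob ?F = on_ob F"
    using on_ob_PiE
    by (intro extensionalityI[of _ "Ob M"])
      (auto simp: natmod_comp_def free_inclusion_def extension_simps source.xobs_incl img_incl PiE_iff)
  show "on_ar ?F = on_ar F"
  proof (rule extensionalityI[of _ "Ar M"])
    fix \<sigma> assume "\<sigma> \<in> Ar M"
    then have \<sigma>: "\<sigma> \<in> Hom M (Dom M \<sigma>) (Cod M \<sigma>)" by (simp add: Hom_def)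
    note F\<sigma> = on_ar_Hom[OF \<sigma>]
    \<comment> \<open>Without basic variables both projections to the base are identities, so the
      equation over the base already reads off the value.\<close>
    have "ext_ar (source.incl_ar \<sigma>) = on_ar F \<sigma>"
      using F\<sigma>
      by (intro ext_ar_eqI[OF source.incl_ar_Hom[OF \<sigma>]])
        (simp_all add: img_incl base_map_incl source.incl_ar_def target.Comp_Id_left[OF F\<sigma>]
          target.Comp_Id_right[OF F\<sigma>])
    with extension_simps(2)[OF source.incl_ar_Hom[OF \<sigma>]] \<open>\<sigma> \<in> Ar M\<close>
    show "on_ar ?F \<sigma> = on_ar F \<sigma>"
      by (simp add: natmod_comp_def free_inclusion_def source.incl_ar_def)
  qed (use on_ar_PiE in \<open>auto simp: natmod_comp_def PiE_iff\<close>)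
  show "on_ty ?F = on_ty F"
  proof (rule extensionalityI[of _ "Ob M"])
    fix \<Gamma> assume \<Gamma>: "\<Gamma> \<in> Ob M"
    show "on_ty ?F \<Gamma> = on_ty F \<Gamma>"
    proof (rule extensionalityI[of _ "sec (Ty M) \<Gamma>"])
      fix A assume A: "A \<in> sec (Ty M) \<Gamma>"
      then show "on_ty ?F \<Gamma> A = on_ty F \<Gamma> A"
        using \<Gamma> on_ty_closed[OF \<Gamma> A]
        by (simp add: natmod_comp_def free_inclusion_def extension_simps source.xobs_incl
            old_ty_def base_map_incl on_ob_closed target.Ty.act_Id)
    qed (use \<Gamma> on_ty_PiE in \<open>auto simp: natmod_comp_def PiE_iff\<close>)
  qed (use on_ty_PiE in \<open>auto simp: natmod_comp_def PiE_iff\<close>)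
  show "on_tm ?F = on_tm F"
  proof (rule extensionalityI[of _ "Ob M"])
    fix \<Gamma> assume \<Gamma>: "\<Gamma> \<in> Ob M"
    show "on_tm ?F \<Gamma> = on_tm F \<Gamma>"
    proof (rule extensionalityI[of _ "sec (Tm M) \<Gamma>"])
      fix a assume a: "a \<in> sec (Tm M) \<Gamma>"
      then show "on_tm ?F \<Gamma> a = on_tm F \<Gamma> a"
        using \<Gamma> on_tm_closed[OF \<Gamma> a]
        by (simp add: natmod_comp_def free_inclusion_def extension_simps source.xobs_incl
            base_map_incl on_ob_closed target.Tm.act_Id)
    qed (use \<Gamma> on_tm_PiE in \<open>auto simp: natmod_comp_def PiE_iff\<close>)
  qed (use on_tm_PiE in \<open>auto simp: natmod_comp_def PiE_iff\<close>)
qed simp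

lemma extension_basic: "on_ty extension (emp (free_model M)) BasicTy = O_ty"
proof -
  \<comment> \<open>This removes the substitution that \<open>basic_ty\<close> puts on
    \<open>O_ty\<close>.\<close>
  have "target.bang (emp N) = Id N (emp N)"
    using target.bang_unique[OF target.Id_Hom] target.emp_closed by simp
  then show ?thesis
    using O_ty_closed target.emp_closed
    by (simp add: extension_simps source.xobs_incl source.emp_closed img_incl on_ob_emp
        basic_ty_def target.Ty.act_Id)
qed

end

theorem theorem4p3p5:
  fixes M :: "('o, 'm, 't, 'e) natmod"
    and N :: "('p, 'n, 'u, 'f) natmod"
    and F :: "('o, 'm, 't, 'e, 'p, 'n, 'u, 'f) natmod_map"
    and O_ty :: 'u
  assumes "natural_model M"
    and "natural_model N"
    and "O_ty \<in> sec (Ty N) (emp N)"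
    and "natural_model_morphism M N F"
  shows "\<exists>!G. natural_model_morphism (free_model M) N G \<and>
    natmod_comp M G (free_inclusion M) = F \<and>
    on_ty G (emp (free_model M)) BasicTy = O_ty"
proof -
  interpret free_extension M N F O_ty
    using assms by (intro free_extension.intro free_extension_axioms.intro)
  show ?thesis
  proof (rule ex1I[of _ extension])
    fix G
    assume "natural_model_morphism (free_model M) N G \<and>
      natmod_comp M G (free_inclusion M) = F \<and>
      on_ty G (emp (free_model M)) BasicTy = O_ty"
    then interpret free_extension_solution M N F O_ty G
      by (intro free_extension_solution.intro free_extension_solution_axioms.intro
          free_extension_axioms) auto
    show "G = extension" by (rule G_eq_extension)
  qed (use morphism_extension extension_inclusion extension_basic in blast)
qed

end
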